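(* For every integer $N\geq 1$, the following identity of polynomials in the indeterminates $x_1,x_2,x_3$ holds: $$\sum_{n_1,n_2,n_3\geq 1}\frac{M(n_1,n_2,n_3,N)}{(N!)^2}\,x_1^{n_1}x_2^{n_2}x_3^{n_3}=\sum_{p_1,p_2,p_3\geq 1}\binom{x_1}{p_1}\binom{x_2}{p_2}\binom{x_3}{p_3}\binom{N-1}{p_3-1}\sum_{a\geq 0}\binom{N-p_2}{p_1-1-a}\binom{N-p_3}{a}\binom{N-1-a}{N-p_2}.$$
   Context: $S_N$ is the symmetric group on $[N]=\{1,\dots,N\}$ and $\gamma_N=(1\,2\,\cdots\,N)$ is the long cycle. For positive integers $n_1,n_2,n_3$, $M(n_1,n_2,n_3,N)$ is the number of triples $(\alpha_1,\alpha_2,\alpha_3)\in S_N^3$ with $\alpha_1\circ\alpha_2\circ\alpha_3=\gamma_N$ such that $\alpha_i$ has exactly $n_i$ cycles for $i=1,2,3$. For an indeterminate $x$ and integer $p\ge 0$, $\binom{x}{p}=x(x-1)\cdots(x-p+1)/p!$. For integers $n,k$, $\binom{n}{k}=\frac{n!}{k!(n-k)!}$ if $0\le k\le n$ and $\binom{n}{k}=0$ otherwise (so all sums are finite). *)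

theory Defs
  imports
    "HOL-Computational_Algebra.Polynomial"
    "HOL-Combinatorics.Orbits"
    "HOL-Combinatorics.Cycles"
    "HOL-Library.Groups_Big_Fun"
begin

definition long_cycle :: "nat \<Rightarrow> nat \<Rightarrow> nat" where
  "long_cycle N = cycle_of_list [1..<Suc N]"

lemma long_cycle_apply:
  assumes "i \<in> {1..N}"
  shows "long_cycle N i = (if i = N then 1 else Suc i)"
proof -
  have "map (long_cycle N) [1..<Suc N] = rotate1 [1..<Suc N]"
    using cyclic_rotation[of "[1..<Suc N]" 1] by (simp add: long_cycle_def)
  then have "map (long_cycle N) [1..<Suc N] ! (i - 1) = rotate1 [1..<Suc N] ! (i - 1)"
    by (rule arg_cong)
  moreover have "i - 1 < N" using assms by auto
  ultimately show ?thesis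
    using assms by (auto simp del: upt_Suc simp: nth_rotate1 nth_upt)
qed

(* Fixed points are counted as cycles: orbit \<pi> i = {i} if \<pi> i = i. *)
definition num_cycles :: "nat \<Rightarrow> (nat \<Rightarrow> nat) \<Rightarrow> nat" where
  "num_cycles N \<pi> = card (orbit \<pi> ` {1..N})"

definition factorizations :: "nat \<Rightarrow> nat \<Rightarrow> nat \<Rightarrow> nat \<Rightarrow>
    ((nat \<Rightarrow> nat) \<times> (nat \<Rightarrow> nat) \<times> (nat \<Rightarrow> nat)) set" where
  "factorizations n1 n2 n3 N = {(\<alpha>1, \<alpha>2, \<alpha>3).
     \<alpha>1 permutes {1..N} \<and> \<alpha>2 permutes {1..N} \<and> \<alpha>3 permutes {1..N} \<and>
     \<alpha>1 \<circ> \<alpha>2 \<circ> \<alpha>3 = long_cycle N \<and>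
     num_cycles N \<alpha>1 = n1 \<and> num_cycles N \<alpha>2 = n2 \<and> num_cycles N \<alpha>3 = n3}"

definition M :: "nat \<Rightarrow> nat \<Rightarrow> nat \<Rightarrow> nat \<Rightarrow> nat" where
  "M n1 n2 n3 N = card (factorizations n1 n2 n3 N)"

definition int_binom :: "int \<Rightarrow> int \<Rightarrow> int" where
  "int_binom n k = (if 0 \<le> k \<and> k \<le> n then int (nat n choose nat k) else 0)"

(* Q[x1,x2,x3] is represented as the iterated polynomial ring Q[x1][x2][x3]. *)
type_synonym rat_poly3 = "rat poly poly poly"

definition Const :: "rat \<Rightarrow> rat_poly3" where
  "Const c = [:[:[:c:]:]:]"

definition X1 :: rat_poly3 where "X1 = [:[:[:0, 1:]:]:]"
definition X2 :: rat_poly3 where "X2 = [:[:0, 1:]:]"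
definition X3 :: rat_poly3 where "X3 = [:0, 1:]"

(* The library's gbinomial is restricted to fields, so it is not available for polynomials. *)
definition poly_binom :: "rat_poly3 \<Rightarrow> nat \<Rightarrow> rat_poly3" where
  "poly_binom x p = Const (1 / fact p) * (\<Prod>i<p. x - of_nat i)"

(* Sum_any is 0 for functions of infinite support; that this never occurs here is shown by the
   finite_support lemmas below. *)
definition sum_pos3 :: "(nat \<Rightarrow> nat \<Rightarrow> nat \<Rightarrow> 'a::comm_monoid_add) \<Rightarrow> 'a" where
  "sum_pos3 f = Sum_any (\<lambda>(i, j, k). if 1 \<le> i \<and> 1 \<le> j \<and> 1 \<le> k then f i j k else 0)"

lemma finite_support_inner:
  "finite {a. int_binom (int N - int p2) (int p1 - 1 - int a) * int_binom (int N - int p3) (int a) *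
     int_binom (int N - 1 - int a) (int N - int p2) \<noteq> 0}"
proof (rule finite_subset)
  show "{a. int_binom (int N - int p2) (int p1 - 1 - int a) * int_binom (int N - int p3) (int a) *
     int_binom (int N - 1 - int a) (int N - int p2) \<noteq> 0} \<subseteq> {..N}"
    by (auto simp: int_binom_def split: if_splits)
qed auto

lemma finite_support_gf:
  "finite {(n1, n2, n3). M n1 n2 n3 N \<noteq> 0}"
proof (rule finite_subset)
  show "{(n1, n2, n3). M n1 n2 n3 N \<noteq> 0} \<subseteq> {..N} \<times> {..N} \<times> {..N}"
  proof (rule subsetI, clarsimp)
    fix n1 n2 n3 assume "M n1 n2 n3 N > 0"
    then have "factorizations n1 n2 n3 N \<noteq> {}" by (auto simp: M_def)
    moreover have "num_cycles N \<pi> \<le> N" for \<pi>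
      unfolding num_cycles_def using card_image_le[of "{1..N}" "orbit \<pi>"] by simp
    ultimately show "n1 \<le> N \<and> n2 \<le> N \<and> n3 \<le> N"
      by (auto simp: factorizations_def)
  qed
qed auto

lemma finite_support_outer:
  assumes "N \<ge> 1"
  shows "finite {(p1, p2, p3). 1 \<le> p1 \<and> 1 \<le> p2 \<and> 1 \<le> p3 \<and>
    int_binom (int N - 1) (int p3 - 1) *
    Sum_any (\<lambda>a. int_binom (int N - int p2) (int p1 - 1 - int a) * int_binom (int N - int p3) (int a) *
      int_binom (int N - 1 - int a) (int N - int p2)) \<noteq> 0}" (is "finite ?S")
proof (rule finite_subset)
  show "?S \<subseteq> {..N} \<times> {..N} \<times> {..N}"
  proof
    fix x assume "x \<in> ?S"
    let ?f = "\<lambda>p1 p2 p3 a. int_binom (int N - int p2) (int p1 - 1 - int a) * int_binom (int N - int p3) (int a) *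
      int_binom (int N - 1 - int a) (int N - int p2)"
    from \<open>x \<in> ?S\<close> obtain p1 p2 p3 where x: "x = (p1, p2, p3)"
      and nz: "int_binom (int N - 1) (int p3 - 1) * Sum_any (?f p1 p2 p3) \<noteq> 0"
      by blast
    from nz have "Sum_any (?f p1 p2 p3) \<noteq> 0" by auto
    then obtain a where "?f p1 p2 p3 a \<noteq> 0"
      by (rule Sum_any.not_neutral_obtains_not_neutral)
    then have "p2 \<le> N" "int p1 - 1 - int a \<le> int N - int p2" "int N - int p2 \<le> int N - 1 - int a"
      by (auto simp: int_binom_def split: if_splits)
    moreover have "p3 \<le> N"
      using nz by (auto simp: int_binom_def split: if_splits)
    ultimately show "x \<in> {..N} \<times> {..N} \<times> {..N}"
      by (simp add: x)
  qed
qed auto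

end

(* Fix a base point i and put S = {1..N}. For J contained in S - {i}, let hook J be the Young
   symmetrizer with column insert i J and row S - J, viewed as a function on permutations of S.
   1. Convolving hook J with a class function multiplies it by a scalar (von Neumann's lemma); for
      x^(number of cycles) the scalar is (x - k)(x - k + 1)...(x - k + N - 1), where k = card J.
   2. The alternating sum of hook J over all J is N times the indicator of the long cycles.
   Summing over all triples of permutations, weighted by x1, x2, x3 to the numbers of cycles, the
   alternating sum of the hook J at their product thus gives
     N! * (sum over factorizations of the long cycle)
       = sum_k (-1)^k C(N-1,k) prod_i (x_i - k)...(x_i - k + N - 1).
   Vandermonde's identity expands each factor, divided by N!, as sum_p C(x_i,p) C(N-1-k,N-p), and
   what remains is a binomial identity. *)
theory Submission
  imports Defs
begin

subsection \<open>Cycle counts\<close>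

text \<open>In character language the sum over \<open>k\<close> runs over the hook shapes: the
  irreducible characters of the symmetric group that do not vanish on a long cycle are those of the
  hooks, with value (-1)^k there. The symmetrizers reach the same formula without representation
  theory. A single \<open>hook\<close> is not a class function; the weights
  \<open>x ^ cyc S p\<close> are, which is why they can be removed from a triple product one at a
  time. Column and row share exactly one point, the base point \<open>i\<close>. Hence the cycle
  numbers of a column and a row permutation add up to one more than that of their product, and the
  scalar becomes a product of consecutive factors. The alternating sum cannot single out one long
  cycle: it detects all (N-1)! of them, each with weight N. Conjugation makes the weighted count of
  factorizations the same for each, whence the factor N!. The sum over \<open>k\<close> is symmetric
  in the three variables; the asymmetric right-hand side arises when C(N-1,k) and the binomial of
  the third variable are rewritten so that C(N-1,p3-1) comes out.\<close>

definition cyc :: "'a set \<Rightarrow> ('a \<Rightarrow> 'a) \<Rightarrow> nat" where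
  "cyc S p = card (orbit p ` S)"

lemma permutes_insert_obtain:
  assumes "p permutes insert a S"
  obtains b q where "p = transpose a b \<circ> q" "b \<in> insert a S" "q permutes S"
proof -
  have "p \<in> {p. p permutes insert a S}" using assms by simp
  then show ?thesis unfolding permutes_insert using that by auto
qed

lemma orbit_refl:
  assumes "p permutes S" "finite S"
  shows "x \<in> orbit p x"
  using assms permutation_permutes permutation_self_in_orbit by metis

lemma orbit_eq_if_mem:
  assumes "p permutes S" "finite S" "y \<in> orbit p x"
  shows "orbit p y = orbit p x"
proof
  show "orbit p y \<subseteq> orbit p x" using assms(3) by (auto intro: orbit_trans)
  have "x \<in> orbit p y" by (rule orbit_swap[OF orbit_refl[OF assms(1,2)] assms(3)])
  then show "orbit p x \<subseteq> orbit p y" by (auto intro: orbit_trans)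
qed

text \<open>Since \<open>p\<close> fixes \<open>a\<close>, the composite sends the
  \<open>p\<close>-preimage of \<open>b\<close> to \<open>a\<close> and \<open>a\<close> to
  \<open>b\<close>. So \<open>a\<close> is spliced into the cycle of \<open>b\<close>, just before
  \<open>b\<close>, and the other cycles stay as they are.\<close>

lemma orbit_transpose_comp:
  assumes p: "p permutes S" and fin: "finite S" and a: "a \<notin> S" and b: "b \<in> S" and x: "x \<in> S"
  shows "orbit (transpose a b \<circ> p) x =
    (if b \<in> orbit p x then insert a (orbit p x) else orbit p x)" (is "orbit ?q x = ?R")
proof
  have pa: "p a = a" using p a by (simp add: permutes_not_in)
  have S: "y \<in> S" if "y \<in> orbit p x" for y
    using permutes_orbit_subset[OF p x] that by auto
  show "orbit ?q x \<subseteq> ?R"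
  proof
    fix y assume "y \<in> orbit ?q x"
    then show "y \<in> ?R"
    proof induction
      case base
      have "p x \<in> orbit p x" "p x \<noteq> a" using S[of "p x"] a by (auto intro: orbit.base)
      then show ?case by (auto simp: transpose_def)
    next
      case (step y)
      show ?case
      proof (cases "y = a")
        case True
        then show ?thesis using step.IH pa S a by (auto simp: transpose_def split: if_splits)
      next
        case False
        then have "y \<in> orbit p x" using step.IH by (auto split: if_splits)
        then have "p y \<in> orbit p x" "p y \<noteq> a" using S[of "p y"] a by (auto intro: orbit.step)
        then show ?thesis by (auto simp: transpose_def)
      qed
    qed
  qed
  have sub: "y \<in> orbit ?q x" if "y \<in> orbit p x" for y
    using that
  proof induction
    case base
    have ne: "p x \<noteq> a" using S[OF orbit.base] a by auto
    have q1: "?q x \<in> orbit ?q x" by (rule orbit.base)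
    then have "?q (?q x) \<in> orbit ?q x" by (rule orbit.step)
    with q1 show ?case using ne pa by (cases "p x = b") (auto simp: comp_def)
  next
    case (step y)
    have ne: "p y \<noteq> a" using S[OF orbit.step[OF step.hyps]] a by auto
    have q1: "?q y \<in> orbit ?q x" using step.IH by (rule orbit.step)
    then have "?q (?q y) \<in> orbit ?q x" by (rule orbit.step)
    with q1 show ?case using ne pa by (cases "p y = b") (auto simp: comp_def)
  qed
  moreover have "a \<in> orbit ?q x" if "b \<in> orbit p x"
  proof -
    \<comment> \<open>The predecessor of \<open>b\<close> lies on the same orbit, and the composite
      sends it to \<open>a\<close>.\<close>
    have "inv p b \<in> orbit p b"
      using orbit_inv_eq[of p b] p fin orbit.base[of "inv p" b] permutation_permutes by metis
    then have "inv p b \<in> orbit p x" using orbit_trans[OF _ that] by blast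
    then have "?q (inv p b) \<in> orbit ?q x" by (intro orbit.step sub)
    then show ?thesis by (simp add: permutes_inverses(1)[OF p])
  qed
  ultimately show "?R \<subseteq> orbit ?q x" by auto
qed

text \<open>Each permutation of \<open>insert a S\<close> has this form for exactly one
  \<open>b\<close> and \<open>p\<close>, so this is the step of the inductions below:
  \<open>a\<close> is either a new fixed point or spliced into an existing cycle.\<close>

lemma cyc_insert:
  assumes p: "p permutes S" and fin: "finite S" and a: "a \<notin> S" and b: "b \<in> insert a S"
  shows "cyc (insert a S) (transpose a b \<circ> p) = cyc S p + (if a = b then 1 else 0)"
proof (cases "a = b")
  case True
  have "orbit p a = {a}" using p a by (simp add: orbit_eq_singleton_iff permutes_not_in)
  moreover have "{a} \<notin> orbit p ` S"
    using permutes_orbit_subset[OF p] a orbit_refl[OF p fin] by (metis imageE insert_subset)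
  ultimately show ?thesis using True fin by (simp add: cyc_def)
next
  case False
  then have bS: "b \<in> S" using b by auto
  let ?q = "transpose a b \<circ> p"
  let ?g = "\<lambda>A. if b \<in> A then insert a A else A"
  have qp: "?q permutes insert a S"
    using permutes_compose[OF permutes_subset[OF p subset_insertI] permutes_swap_id[of a "insert a S" b]] bS
    by auto
  have "?q a = b" using p a by (simp add: permutes_not_in)
  then have "b \<in> orbit ?q a" by (metis orbit.base)
  then have "orbit ?q a = orbit ?q b" using orbit_eq_if_mem[OF qp] fin by auto
  then have "orbit ?q ` insert a S = orbit ?q ` S" using bS by auto
  also have "\<dots> = ?g ` (orbit p ` S)"
    unfolding image_image by (rule image_cong) (auto simp: orbit_transpose_comp[OF p fin a bS])
  also have "card \<dots> = card (orbit p ` S)"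
  proof (rule card_image, rule inj_onI)
    fix A B assume *: "A \<in> orbit p ` S" "B \<in> orbit p ` S" "?g A = ?g B"
    have "a \<notin> A" "a \<notin> B" using *(1,2) permutes_orbit_subset[OF p] a by auto
    with *(3) show "A = B" using False by (auto split: if_splits)
  qed
  finally show ?thesis using False by (simp add: cyc_def)
qed

lemma cyc_conj:
  assumes p: "p permutes S" and g: "g permutes S"
  shows "cyc S (g \<circ> p \<circ> inv g) = cyc S p"
proof -
  have o: "orbit (g \<circ> p \<circ> inv g) (g x) = g ` orbit p x" for x
  proof -
    have "((g \<circ> p \<circ> inv g) ^^ n) (g x) = g ((p ^^ n) x)" for n
      by (induction n) (auto simp: permutes_inverses[OF g])
    then show ?thesis by (auto simp: orbit_altdef image_iff)
  qed
  have "orbit (g \<circ> p \<circ> inv g) ` S = orbit (g \<circ> p \<circ> inv g) ` (g ` S)"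
    by (simp add: permutes_image[OF g])
  also have "\<dots> = (image g) ` (orbit p ` S)" by (simp add: image_image o)
  finally have "cyc S (g \<circ> p \<circ> inv g) = card ((image g) ` (orbit p ` S))"
    by (simp only: cyc_def)
  also have "\<dots> = cyc S p"
    unfolding cyc_def by (rule card_image) (simp add: inj_on_def inj_image_eq_iff[OF permutes_inj[OF g]])
  finally show ?thesis .
qed

text \<open>The two sets meet only in \<open>i\<close>, so the product merges the two cycles through
  \<open>i\<close> and no others. The induction strips from \<pi> the points other than
  \<open>i\<close>; each of them changes both sides by the same amount.\<close>

lemma cyc_mult_overlap:
  assumes "finite A" and "\<pi> permutes insert i A" and "\<sigma> permutes T" and "finite T"
    and "i \<in> T" and "A \<inter> T = {}"
  shows "Suc (cyc (A \<union> T) (\<pi> \<circ> \<sigma>)) = cyc (insert i A) \<pi> + cyc T \<sigma>"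
  using assms
proof (induction A arbitrary: \<pi> rule: finite_induct)
  case empty
  have "orbit id i = {i}" by (simp add: orbit_eq_singleton_iff)
  with empty show ?case by (simp add: cyc_def)
next
  case (insert a A)
  from insert.prems have "\<pi> permutes insert a (insert i A)" by (simp add: insert_commute)
  then obtain b q where q: "\<pi> = transpose a b \<circ> q" "b \<in> insert a (insert i A)" "q permutes insert i A"
    by (rule permutes_insert_obtain)
  have ai: "a \<notin> insert i A" "a \<notin> A \<union> T" using insert by auto
  have "q \<circ> \<sigma> permutes A \<union> T"
    using q(3) insert.prems by (intro permutes_compose) (auto intro: permutes_subset)
  then have "cyc (insert a (A \<union> T)) (transpose a b \<circ> (q \<circ> \<sigma>)) = cyc (A \<union> T) (q \<circ> \<sigma>) + (if a = b then 1 else 0)"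
    using q(2) insert ai by (intro cyc_insert) auto
  moreover have "cyc (insert a (insert i A)) \<pi> = cyc (insert i A) q + (if a = b then 1 else 0)"
    unfolding q(1) using q insert ai by (intro cyc_insert) auto
  moreover have "Suc (cyc (A \<union> T) (q \<circ> \<sigma>)) = cyc (insert i A) q + cyc T \<sigma>"
    using insert q by (intro insert.IH) auto
  ultimately show ?case by (simp add: q(1) comp_def insert_commute)
qed

lemma cyc_pos:
  assumes "finite S" "S \<noteq> {}"
  shows "cyc S p > 0"
  using assms by (simp add: cyc_def card_gt_0_iff)

lemma sign_eq_cyc:
  assumes "finite S" "p permutes S"
  shows "sign p = (-1) ^ (card S + cyc S p)"
  using assms
proof (induction S arbitrary: p rule: finite_induct)
  case empty
  then show ?case by (simp add: cyc_def)
next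
  case (insert a S)
  from insert.prems obtain b q where q: "p = transpose a b \<circ> q" "b \<in> insert a S" "q permutes S"
    by (rule permutes_insert_obtain)
  have "sign p = sign (transpose a b) * sign q"
    unfolding q(1) using q(3) insert.hyps(1)
    by (intro sign_compose permutation_swap_id) (auto simp: permutation_permutes)
  moreover have "cyc (insert a S) p = cyc S q + (if a = b then 1 else 0)"
    unfolding q(1) using q insert by (intro cyc_insert) auto
  ultimately show ?case using insert.IH[OF q(3)] insert.hyps by (auto simp: sign_swap_id)
qed

text \<open>Of the places for \<open>a\<close>, one opens a new cycle and \<open>card S\<close> keep
  the count. The function \<open>f\<close> is arbitrary because powers and the indicator of a single
  cycle are both needed.\<close>

lemma sum_cyc_insert:
  fixes f :: "nat \<Rightarrow> 'b::comm_semiring_1"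
  assumes "finite S" "a \<notin> S"
  shows "(\<Sum>p | p permutes insert a S. f (cyc (insert a S) p)) =
    (\<Sum>p | p permutes S. f (Suc (cyc S p)) + of_nat (card S) * f (cyc S p))"
proof -
  have "(\<Sum>p | p permutes insert a S. f (cyc (insert a S) p)) =
    (\<Sum>b\<in>insert a S. \<Sum>p | p permutes S. f (cyc S p + (if a = b then 1 else 0)))"
    unfolding sum_over_permutations_insert[OF assms]
    by (intro sum.cong refl arg_cong[of _ _ f] cyc_insert) (use assms in auto)
  also have "\<dots> = (\<Sum>p | p permutes S. \<Sum>b\<in>insert a S. f (cyc S p + (if a = b then 1 else 0)))"
    by (rule sum.swap)
  also have "\<dots> = (\<Sum>p | p permutes S. f (Suc (cyc S p)) + of_nat (card S) * f (cyc S p))"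
  proof (rule sum.cong[OF refl])
    fix p
    have "(\<Sum>b\<in>S. f (cyc S p + (if a = b then 1 else 0))) = (\<Sum>b\<in>S. f (cyc S p))"
      by (rule sum.cong) (use assms in auto)
    then show "(\<Sum>b\<in>insert a S. f (cyc S p + (if a = b then 1 else 0))) =
      f (Suc (cyc S p)) + of_nat (card S) * f (cyc S p)"
      using assms by simp
  qed
  finally show ?thesis .
qed

lemma sum_power_cyc:
  fixes x :: "'b::comm_ring_1"
  assumes "finite S"
  shows "(\<Sum>p | p permutes S. x ^ cyc S p) = pochhammer x (card S)"
  using assms
proof (induction S rule: finite_induct)
  case empty
  then show ?case by (simp add: cyc_def)
next
  case (insert a S)
  have "(\<Sum>p | p permutes insert a S. x ^ cyc (insert a S) p) =
    (\<Sum>p | p permutes S. x ^ cyc S p) * (x + of_nat (card S))"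
    unfolding sum_cyc_insert[OF insert.hyps] sum_distrib_right
    by (intro sum.cong) (auto simp: algebra_simps)
  then show ?case using insert by (simp add: pochhammer_Suc)
qed

text \<open>By \<open>sign_eq_cyc\<close> the sign amounts to replacing x by -x, up to a global
  sign. The rising factorial becomes x(x-1)...(x-n), written here from its smallest factor
  upwards.\<close>

lemma sum_sign_power_cyc:
  fixes x :: "'b::comm_ring_1"
  assumes "finite S" "card S = Suc n"
  shows "(\<Sum>p | p permutes S. of_int (sign p) * x ^ cyc S p) = pochhammer (x - of_nat n) (Suc n)"
proof -
  have "(\<Sum>p | p permutes S. of_int (sign p) * x ^ cyc S p) = (-1) ^ card S * (\<Sum>p | p permutes S. (- x) ^ cyc S p)"
    unfolding sum_distrib_left
    by (intro sum.cong) (auto simp: sign_eq_cyc[OF assms(1)] power_add power_minus[of x])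
  also have "\<dots> = pochhammer (x - of_nat n) (Suc n)"
    unfolding sum_power_cyc[OF assms(1)] using pochhammer_minus'[of x n]
    by (simp add: assms(2) pochhammer_minus algebra_simps)
  finally show ?thesis .
qed

lemma card_cyc_eq_1:
  assumes "finite S" "S \<noteq> {}"
  shows "card {p. p permutes S \<and> cyc S p = 1} = fact (card S - 1)"
  using assms
proof (induction S rule: finite_ne_induct)
  case (singleton x)
  have "{p. p permutes {x} \<and> cyc {x} p = 1} = {id}" by (auto simp: cyc_def)
  then show ?case by simp
next
  case (insert a S)
  have *: "card {p. p permutes S \<and> cyc S p = 1} = (\<Sum>p | p permutes S. if cyc S p = 1 then 1 else 0)"
    if "finite S" for S :: "'a set"
    using that by (simp add: sum.If_cases finite_permutations Int_def)
  have "card {p. p permutes insert a S \<and> cyc (insert a S) p = 1} =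
     (\<Sum>p | p permutes S. (if Suc (cyc S p) = 1 then 1 else 0) + of_nat (card S) * (if cyc S p = 1 then 1 else 0))"
    using insert.hyps sum_cyc_insert[OF insert.hyps(1,3), of "\<lambda>c. if c = 1 then 1 else 0 :: nat"]
    by (simp only: *[of "insert a S"] finite_insert)
  \<comment> \<open>A new fixed point beside the nonempty \<open>S\<close> never gives a single
    cycle.\<close>
  also have "\<dots> = (\<Sum>p | p permutes S. card S * (if cyc S p = 1 then 1 else 0))"
    using cyc_pos[OF insert.hyps(1,2)] by (intro sum.cong) auto
  also have "\<dots> = card S * fact (card S - 1)"
    unfolding sum_distrib_left[symmetric] using insert.IH *[OF insert.hyps(1)] by simp
  also have "\<dots> = fact (card S)"
    using insert.hyps by (metis card_gt_0_iff fact_reduce of_nat_id)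
  finally show ?case using insert.hyps by simp
qed

subsection \<open>Hook Young symmetrizers\<close>

text \<open>An injection of the finite set \<open>K\<close> into itself is onto, so the complement
  of \<open>K\<close> is invariant as well.\<close>

lemma permutes_split_invariant:
  assumes p: "p permutes S" and fin: "finite S" and K: "K \<subseteq> S" "p ` K \<subseteq> K"
  shows "perm_restrict p K permutes K" "perm_restrict p (S - K) permutes S - K"
    "p = perm_restrict p (S - K) \<circ> perm_restrict p K"
proof -
  have pK: "p ` K = K"
    using K fin by (intro endo_inj_surj) (auto simp: finite_subset permutes_inj_on[OF p])
  then have pK': "p ` (S - K) = S - K"
    using K by (simp add: image_set_diff[OF permutes_inj[OF p]] permutes_image[OF p])
  show 1: "perm_restrict p K permutes K"
    by (intro bij_imp_permutes)
      (auto simp: perm_restrict_simps bij_betw_def inj_on_def pK permutes_inj[OF p, THEN injD]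
        cong: image_cong_simp)
  show 2: "perm_restrict p (S - K) permutes S - K"
    by (intro bij_imp_permutes)
      (auto simp: perm_restrict_simps bij_betw_def inj_on_def pK' permutes_inj[OF p, THEN injD]
        cong: image_cong_simp)
  show "p = perm_restrict p (S - K) \<circ> perm_restrict p K"
    using perm_restrict_union[OF 2 1] p K by (simp add: Un_absorb2 Int_commute)
qed

locale hook_shape =
  fixes i :: 'a and S J :: "'a set"
  assumes fin: "finite S" and iS: "i \<in> S" and JS: "J \<subseteq> S - {i}"
begin

text \<open>At most one summand is nonzero: \<open>hook \<beta>\<close> is the sign of \<open>\<pi>\<close> if \<open>\<beta>\<close> factors as a column
  permutation \<open>\<pi>\<close> times a row permutation, and \<open>0\<close> otherwise.\<close>

definition hook :: "('a \<Rightarrow> 'a) \<Rightarrow> int" where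
  "hook \<beta> = (\<Sum>\<pi> | \<pi> permutes insert i J. if inv \<pi> \<circ> \<beta> permutes S - J then sign \<pi> else 0)"

lemma fin_row_col: "finite (insert i J)" "finite (S - J)"
  using fin JS by (auto intro: finite_subset)

lemma sub_row_col: "insert i J \<subseteq> S" "S - J \<subseteq> S"
  using iS JS by auto

lemma perm_col: "\<pi> permutes insert i J \<Longrightarrow> \<pi> permutes S"
  using sub_row_col permutes_subset by metis

lemma perm_row: "\<sigma> permutes S - J \<Longrightarrow> \<sigma> permutes S"
  using sub_row_col permutes_subset by metis

lemma permutes_both_imp_id:
  assumes "p permutes insert i J" "p permutes S - J"
  shows "p = id"
proof -
  have "p permutes {i}"
    by (rule permutes_superset[OF assms(1)]) (use assms(2) in \<open>auto simp: permutes_not_in\<close>)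
  then show ?thesis by simp
qed

text \<open>Column and row meet only in \<open>i\<close>, so their permutation groups share only the
  identity. A factorization is therefore unique, and one summand survives.\<close>

lemma hook_mult:
  assumes "\<pi> permutes insert i J" "\<sigma> permutes S - J"
  shows "hook (\<pi> \<circ> \<sigma>) = sign \<pi>"
proof -
  have "inv p \<circ> (\<pi> \<circ> \<sigma>) permutes S - J \<longleftrightarrow> p = \<pi>" if p: "p permutes insert i J" for p
  proof
    assume "inv p \<circ> (\<pi> \<circ> \<sigma>) permutes S - J"
    from permutes_compose[OF permutes_inv[OF assms(2)] this]
    have "inv p \<circ> \<pi> permutes S - J"
      by (simp add: comp_assoc permutes_inv_o[OF assms(2)])
    moreover have "inv p \<circ> \<pi> permutes insert i J"
      by (rule permutes_compose[OF assms(1) permutes_inv[OF p]])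
    ultimately have "inv p \<circ> \<pi> = id" by (intro permutes_both_imp_id)
    then have "p \<circ> (inv p \<circ> \<pi>) = p" by simp
    then show "p = \<pi>" by (simp add: comp_assoc[symmetric] permutes_inv_o[OF p])
  next
    assume "p = \<pi>"
    then show "inv p \<circ> (\<pi> \<circ> \<sigma>) permutes S - J"
      using assms by (simp add: comp_assoc[symmetric] permutes_inv_o)
  qed
  then have "hook (\<pi> \<circ> \<sigma>) = (\<Sum>p | p permutes insert i J. if p = \<pi> then sign p else 0)"
    unfolding hook_def by (intro sum.cong) auto
  also have "\<dots> = sign \<pi>"
    using assms(1) finite_permutations[OF fin_row_col(1)] by simp
  finally show ?thesis .
qed

lemma hook_comp_left:
  assumes "\<pi> permutes insert i J"
  shows "hook (\<pi> \<circ> \<beta>) = sign \<pi> * hook \<beta>"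
proof -
  have "hook (\<pi> \<circ> \<beta>) = (\<Sum>p | p permutes insert i J.
      if inv (\<pi> \<circ> p) \<circ> (\<pi> \<circ> \<beta>) permutes S - J then sign (\<pi> \<circ> p) else 0)"
    unfolding hook_def by (rule setum_permutations_compose_left[OF assms])
  also have "\<dots> = (\<Sum>p | p permutes insert i J.
      sign \<pi> * (if inv p \<circ> \<beta> permutes S - J then sign p else 0))"
  proof (rule sum.cong[OF refl])
    fix p assume "p \<in> {p. p permutes insert i J}"
    then have p: "p permutes insert i J" by simp
    have "inv (\<pi> \<circ> p) = inv p \<circ> inv \<pi>"
      using assms p by (intro o_inv_distrib) (auto intro: permutes_bij)
    then have "inv (\<pi> \<circ> p) \<circ> (\<pi> \<circ> \<beta>) = inv p \<circ> ((inv \<pi> \<circ> \<pi>) \<circ> \<beta>)" by (simp only: comp_assoc)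
    moreover have "sign (\<pi> \<circ> p) = sign \<pi> * sign p"
      using assms p fin_row_col(1) by (intro sign_compose permutes_imp_permutation)
    ultimately show "(if inv (\<pi> \<circ> p) \<circ> (\<pi> \<circ> \<beta>) permutes S - J then sign (\<pi> \<circ> p) else 0) =
        sign \<pi> * (if inv p \<circ> \<beta> permutes S - J then sign p else 0)"
      by (simp add: permutes_inv_o[OF assms])
  qed
  finally show ?thesis by (simp add: hook_def sum_distrib_left)
qed

lemma hook_comp_right:
  assumes "\<sigma> permutes S - J"
  shows "hook (\<beta> \<circ> \<sigma>) = hook \<beta>"
proof -
  have "p \<circ> (\<beta> \<circ> \<sigma>) permutes S - J \<longleftrightarrow> p \<circ> \<beta> permutes S - J" for p
    using permutes_compose[OF assms, of "p \<circ> \<beta>"]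
      permutes_compose[OF permutes_inv[OF assms], of "p \<circ> (\<beta> \<circ> \<sigma>)"]
    by (auto simp: comp_assoc permutes_inv_o[OF assms])
  then show ?thesis by (simp add: hook_def)
qed

lemma hook_nonzero_factor:
  assumes "hook \<beta> \<noteq> 0"
  obtains \<pi> \<sigma> where "\<pi> permutes insert i J" "\<sigma> permutes S - J" "\<beta> = \<pi> \<circ> \<sigma>"
proof -
  from assms obtain \<pi> where \<pi>: "\<pi> permutes insert i J" "inv \<pi> \<circ> \<beta> permutes S - J"
    unfolding hook_def by (auto elim!: sum.not_neutral_contains_not_neutral split: if_splits)
  moreover have "\<beta> = \<pi> \<circ> (inv \<pi> \<circ> \<beta>)"
    by (simp add: comp_assoc[symmetric] permutes_inv_o[OF \<pi>(1)])
  ultimately show ?thesis using that by blast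
qed

text \<open>This dichotomy is the core of von Neumann's lemma. Some row element is always mapped
  into the column; if it is the only one, a single transposition repairs \<beta>, and otherwise
  there is a collision.\<close>

lemma factor_or_collision:
  assumes \<beta>: "\<beta> permutes S"
  obtains (factor) \<pi> \<sigma> where "\<pi> permutes insert i J" "\<sigma> permutes S - J" "\<beta> = \<pi> \<circ> \<sigma>"
  | (collision) t t' where "t \<in> S - J" "t' \<in> S - J" "t \<noteq> t'" "\<beta> t \<in> insert i J" "\<beta> t' \<in> insert i J"
proof (cases "\<exists>t\<in>S - J. \<exists>t'\<in>S - J. t \<noteq> t' \<and> \<beta> t \<in> insert i J \<and> \<beta> t' \<in> insert i J")
  case True
  then show ?thesis using collision by blast
next
  case False
  \<comment> \<open>Pigeonhole: the complement of the column has one element fewer than the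
    row.\<close>
  have "\<exists>t\<in>S - J. \<beta> t \<in> insert i J"
  proof (rule ccontr)
    assume "\<not> ?thesis"
    then have "\<beta> ` (S - J) \<subseteq> S - insert i J"
      using permutes_in_image[OF \<beta>] by auto
    then have "card (\<beta> ` (S - J)) \<le> card (S - insert i J)"
      using fin by (intro card_mono) auto
    moreover have "card (\<beta> ` (S - J)) = card (S - J)"
      by (rule card_image[OF permutes_inj_on[OF \<beta>]])
    moreover have "card (S - insert i J) < card (S - J)"
      using fin iS JS by (intro psubset_card_mono) auto
    ultimately show False by simp
  qed
  then obtain t where t: "t \<in> S - J" "\<beta> t \<in> insert i J" by blast
  \<comment> \<open>The only row image that lies in the column is moved to the shared point
    \<open>i\<close>, which makes the row invariant.\<close>
  define \<tau> where "\<tau> = transpose (\<beta> t) i"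
  have \<tau>: "\<tau> permutes insert i J" unfolding \<tau>_def using t by (intro permutes_swap_id) auto
  define \<beta>' where "\<beta>' = \<tau> \<circ> \<beta>"
  have \<beta>': "\<beta>' permutes S" unfolding \<beta>'_def by (rule permutes_compose[OF \<beta> perm_col[OF \<tau>]])
  have inv: "\<beta>' ` (S - J) \<subseteq> S - J"
  proof (rule image_subsetI)
    fix u assume u: "u \<in> S - J"
    show "\<beta>' u \<in> S - J"
    proof (cases "u = t")
      case True
      then show ?thesis using iS JS by (auto simp: \<beta>'_def \<tau>_def)
    next
      case False
      then have "\<beta> u \<notin> insert i J" using \<open>\<not> (\<exists>t\<in>_. _)\<close> u t by blast
      then show ?thesis
        using u t permutes_in_image[OF \<beta>, of u] by (auto simp: \<beta>'_def \<tau>_def transpose_def)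
    qed
  qed
  note split = permutes_split_invariant[OF \<beta>' fin sub_row_col(2) inv]
  let ?\<pi> = "\<tau> \<circ> perm_restrict \<beta>' (S - (S - J))"
  have "perm_restrict \<beta>' (S - (S - J)) permutes insert i J"
    using split(2) by (rule permutes_subset) auto
  then have "?\<pi> permutes insert i J" using \<tau> by (intro permutes_compose)
  moreover have "\<beta> = ?\<pi> \<circ> perm_restrict \<beta>' (S - J)"
  proof -
    have "\<beta> = \<tau> \<circ> \<beta>'" by (simp add: \<beta>'_def \<tau>_def comp_assoc[symmetric])
    also have "\<dots> = \<tau> \<circ> (perm_restrict \<beta>' (S - (S - J)) \<circ> perm_restrict \<beta>' (S - J))"
      by (rule arg_cong[OF split(3)])
    finally show ?thesis by (simp only: comp_assoc)
  qed
  ultimately show ?thesis using factor split(1) by blast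
qed

text \<open>The convolution inherits the column-antisymmetry and row-symmetry of \<open>hook\<close>. These two force it
  to vanish wherever two elements of the row are mapped into the column.\<close>

lemma hook_eigen:
  fixes z :: "('a \<Rightarrow> 'a) \<Rightarrow> 'b::{idom,ring_char_0}"
  assumes class_fun: "\<And>g p. g permutes S \<Longrightarrow> p permutes S \<Longrightarrow> z (g \<circ> p \<circ> inv g) = z p"
    and \<beta>: "\<beta> permutes S"
  shows "(\<Sum>\<alpha> | \<alpha> permutes S. z \<alpha> * of_int (hook (\<alpha> \<circ> \<beta>))) =
    (\<Sum>\<alpha> | \<alpha> permutes S. z \<alpha> * of_int (hook \<alpha>)) * of_int (hook \<beta>)"
proof -
  define w where "w \<beta> = (\<Sum>\<alpha> | \<alpha> permutes S. z \<alpha> * of_int (hook (\<alpha> \<circ> \<beta>)))" for \<beta>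
  have right: "w (\<beta> \<circ> \<sigma>) = w \<beta>" if "\<sigma> permutes S - J" for \<beta> \<sigma>
    unfolding w_def comp_assoc[symmetric] by (simp add: hook_comp_right[OF that])
  have left: "w (\<pi> \<circ> \<beta>) = of_int (sign \<pi>) * w \<beta>" if "\<pi> permutes insert i J" for \<pi> \<beta>
  proof -
    have \<pi>: "\<pi> permutes S" using that by (rule perm_col)
    \<comment> \<open>The two substitutions together replace \<alpha> by its conjugate under \<pi>.
      This does not affect \<open>z\<close>, and it brings \<pi> to the left end of the argument of
      \<open>hook\<close>.\<close>
    have "w (\<pi> \<circ> \<beta>) = (\<Sum>\<alpha> | \<alpha> permutes S. z (\<pi> \<circ> \<alpha>) * of_int (hook (\<pi> \<circ> \<alpha> \<circ> (\<pi> \<circ> \<beta>))))"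
      unfolding w_def by (rule setum_permutations_compose_left[OF \<pi>])
    also have "\<dots> = (\<Sum>\<alpha> | \<alpha> permutes S. z (\<pi> \<circ> (\<alpha> \<circ> inv \<pi>)) * of_int (hook (\<pi> \<circ> (\<alpha> \<circ> inv \<pi>) \<circ> (\<pi> \<circ> \<beta>))))"
      by (rule sum_permutations_compose_right[OF permutes_inv[OF \<pi>]])
    also have "\<dots> = (\<Sum>\<alpha> | \<alpha> permutes S. of_int (sign \<pi>) * (z \<alpha> * of_int (hook (\<alpha> \<circ> \<beta>))))"
    proof (rule sum.cong[OF refl])
      fix \<alpha> assume "\<alpha> \<in> {p. p permutes S}"
      then have "z (\<pi> \<circ> (\<alpha> \<circ> inv \<pi>)) = z \<alpha>" using class_fun[OF \<pi>, of \<alpha>] by (simp add: comp_assoc)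
      moreover have "\<pi> \<circ> (\<alpha> \<circ> inv \<pi>) \<circ> (\<pi> \<circ> \<beta>) = \<pi> \<circ> (\<alpha> \<circ> ((inv \<pi> \<circ> \<pi>) \<circ> \<beta>))"
        by (simp only: comp_assoc)
      ultimately show "z (\<pi> \<circ> (\<alpha> \<circ> inv \<pi>)) * of_int (hook (\<pi> \<circ> (\<alpha> \<circ> inv \<pi>) \<circ> (\<pi> \<circ> \<beta>))) =
          of_int (sign \<pi>) * (z \<alpha> * of_int (hook (\<alpha> \<circ> \<beta>)))"
        by (simp add: permutes_inv_o[OF \<pi>] hook_comp_left[OF that])
    qed
    finally show ?thesis by (simp add: w_def sum_distrib_left)
  qed
  have "w \<beta> = w id * of_int (hook \<beta>)"
    using \<beta>
  proof (cases rule: factor_or_collision)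
    case (factor \<pi> \<sigma>)
    then show ?thesis
      using left[of \<pi> id] right[of \<sigma> \<pi>] hook_mult[of \<pi> \<sigma>] by simp
  next
    case (collision t t')
    let ?s = "transpose t t'" and ?u = "transpose (\<beta> t) (\<beta> t')"
    have s: "?s permutes S - J" and u: "?u permutes insert i J"
      using collision by (auto intro: permutes_swap_id)
    have ne: "\<beta> t \<noteq> \<beta> t'" using collision(3) permutes_inj[OF \<beta>] by (auto dest: injD)
    \<comment> \<open>A row transposition on the right equals a column transposition on the left:
      the former preserves \<open>w \<beta>\<close> and \<open>hook \<beta>\<close>, the latter
      negates them.\<close>
    have eq: "\<beta> \<circ> ?s = ?u \<circ> \<beta>"
      using permutes_inj[OF \<beta>] by (auto simp: fun_eq_iff transpose_def dest: injD)
    have "w \<beta> = - w \<beta>"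
      using right[OF s, of \<beta>] left[OF u, of \<beta>] ne by (simp add: eq sign_swap_id)
    then have "2 * w \<beta> = 0" by (simp add: eq_neg_iff_add_eq_0)
    then have "w \<beta> = 0" by simp
    moreover have "hook \<beta> = 0"
      using hook_comp_right[OF s, of \<beta>] hook_comp_left[OF u, of \<beta>] ne by (simp add: eq sign_swap_id)
    ultimately show ?thesis by simp
  qed
  then show ?thesis by (simp add: w_def)
qed

text \<open>For each column permutation \<pi>, substituting \<pi> \<circ> \<alpha> for \<alpha>
  turns the condition inside \<open>hook\<close> into membership in the row group.\<close>

lemma sum_over_hook:
  fixes z :: "('a \<Rightarrow> 'a) \<Rightarrow> 'b::comm_ring_1"
  shows "(\<Sum>\<alpha> | \<alpha> permutes S. z \<alpha> * of_int (hook \<alpha>)) =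
    (\<Sum>\<pi> | \<pi> permutes insert i J. \<Sum>\<sigma> | \<sigma> permutes S - J. of_int (sign \<pi>) * z (\<pi> \<circ> \<sigma>))"
proof -
  have "(\<Sum>\<alpha> | \<alpha> permutes S. z \<alpha> * of_int (hook \<alpha>)) = (\<Sum>\<pi> | \<pi> permutes insert i J. \<Sum>\<alpha> | \<alpha> permutes S.
      if inv \<pi> \<circ> \<alpha> permutes S - J then of_int (sign \<pi>) * z \<alpha> else 0)"
    unfolding hook_def of_int_sum sum_distrib_left
    by (subst sum.swap) (intro sum.cong refl, auto)
  also have "\<dots> = (\<Sum>\<pi> | \<pi> permutes insert i J. \<Sum>\<sigma> | \<sigma> permutes S - J. of_int (sign \<pi>) * z (\<pi> \<circ> \<sigma>))"
  proof (rule sum.cong[OF refl])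
    fix \<pi> assume "\<pi> \<in> {p. p permutes insert i J}"
    then have \<pi>: "\<pi> permutes S" using perm_col by auto
    have "(\<Sum>\<alpha> | \<alpha> permutes S. if inv \<pi> \<circ> \<alpha> permutes S - J then of_int (sign \<pi>) * z \<alpha> else 0) =
      (\<Sum>\<alpha> | \<alpha> permutes S. if inv \<pi> \<circ> (\<pi> \<circ> \<alpha>) permutes S - J then of_int (sign \<pi>) * z (\<pi> \<circ> \<alpha>) else 0)"
      by (rule setum_permutations_compose_left[OF \<pi>])
    also have "\<dots> = (\<Sum>\<alpha> | \<alpha> permutes S. if \<alpha> permutes S - J then of_int (sign \<pi>) * z (\<pi> \<circ> \<alpha>) else 0)"
      by (simp add: comp_assoc[symmetric] permutes_inv_o[OF \<pi>])
    also have "\<dots> = (\<Sum>\<sigma> | \<sigma> permutes S - J. of_int (sign \<pi>) * z (\<pi> \<circ> \<sigma>))"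
      using finite_permutations[OF fin] perm_row
      by (subst sum.inter_filter[symmetric]) (auto intro: sum.cong)
    finally show "(\<Sum>\<alpha> | \<alpha> permutes S. if inv \<pi> \<circ> \<alpha> permutes S - J then of_int (sign \<pi>) * z \<alpha> else 0) =
      (\<Sum>\<sigma> | \<sigma> permutes S - J. of_int (sign \<pi>) * z (\<pi> \<circ> \<sigma>))" .
  qed
  finally show ?thesis .
qed

lemma cyc_factor:
  assumes "\<pi> permutes insert i J" "\<sigma> permutes S - J"
  shows "Suc (cyc S (\<pi> \<circ> \<sigma>)) = cyc (insert i J) \<pi> + cyc (S - J) \<sigma>"
proof -
  have "J \<union> (S - J) = S" using JS by auto
  then show ?thesis
    using cyc_mult_overlap[OF _ assms(1) assms(2) fin_row_col(2)] fin_row_col(1) iS JS by auto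
qed

text \<open>With k = \<open>card J\<close> and N = \<open>card S\<close>, the column contributes
  (x-k)...(x-1)x and the row x(x+1)...(x+N-k-1). The factor x occurs twice because \<open>i\<close>
  lies in both; the sum is first multiplied by x and then one x is cancelled.\<close>

lemma hook_eigenvalue:
  fixes x :: "'b::idom"
  assumes "x \<noteq> 0"
  shows "(\<Sum>\<alpha> | \<alpha> permutes S. x ^ cyc S \<alpha> * of_int (hook \<alpha>)) = pochhammer (x - of_nat (card J)) (card S)"
    (is "?L = _")
proof -
  have c: "card (insert i J) = Suc (card J)" using fin_row_col(1) JS by (subst card_insert_disjoint) auto
  have cS: "card S = card J + card (S - J)"
    using fin JS by (metis card_Diff_subset card_mono le_add_diff_inverse finite_subset subset_Diff_insert
        Diff_subset order_trans)
  have "x * ?L = (\<Sum>\<pi> | \<pi> permutes insert i J. \<Sum>\<sigma> | \<sigma> permutes S - J.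
      (of_int (sign \<pi>) * x ^ cyc (insert i J) \<pi>) * x ^ cyc (S - J) \<sigma>)"
    unfolding sum_over_hook sum_distrib_left
  proof (intro sum.cong refl)
    fix \<pi> \<sigma> assume "\<pi> \<in> {p. p permutes insert i J}" "\<sigma> \<in> {p. p permutes S - J}"
    then have "x * x ^ cyc S (\<pi> \<circ> \<sigma>) = x ^ cyc (insert i J) \<pi> * x ^ cyc (S - J) \<sigma>"
      using cyc_factor[of \<pi> \<sigma>] by (simp flip: power_Suc power_add)
    then show "x * (of_int (sign \<pi>) * x ^ cyc S (\<pi> \<circ> \<sigma>)) =
      of_int (sign \<pi>) * x ^ cyc (insert i J) \<pi> * x ^ cyc (S - J) \<sigma>"
      by (simp add: mult.left_commute mult.assoc)
  qed
  also have "\<dots> = pochhammer (x - of_nat (card J)) (Suc (card J)) * pochhammer x (card (S - J))"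
    unfolding sum_product[symmetric] sum_sign_power_cyc[OF fin_row_col(1) c] sum_power_cyc[OF fin_row_col(2)] ..
  also have "\<dots> = x * pochhammer (x - of_nat (card J)) (card S)"
    by (simp add: pochhammer_Suc cS pochhammer_product'[of _ "card J"])
  finally show ?thesis using assms by simp
qed

end

subsection \<open>The alternating sum of hooks\<close>

lemma cyc_eq_1_orbit:
  assumes p: "p permutes S" and fin: "finite S" and c: "cyc S p = 1" and x: "x \<in> S"
  shows "orbit p x = S"
proof
  show "orbit p x \<subseteq> S" by (rule permutes_orbit_subset[OF p x])
  from c obtain A where "orbit p ` S = {A}" by (auto simp: cyc_def card_1_singleton_iff)
  then have "orbit p y = orbit p x" if "y \<in> S" for y using that x by blast
  then show "S \<subseteq> orbit p x" using orbit_refl[OF p fin] by blast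
qed

lemma funpow_bij_betw_if_cyc_eq_1:
  assumes "p permutes S" "finite S" "cyc S p = 1" "x \<in> S"
  shows "bij_betw (\<lambda>m. (p ^^ m) x) {..<card S} S" "(p ^^ card S) x = x"
proof -
  note o = cyc_eq_1_orbit[OF assms]
  have x: "x \<in> orbit p x" using o assms(4) by simp
  let ?d = "funpow_dist1 p x x"
  have "bij_betw (\<lambda>m. (p ^^ m) x) {0..<?d} S"
    using inj_on_funpow_dist1[OF x] orbit_conv_funpow_dist1[OF x] o by (simp add: bij_betw_def)
  moreover from this have d: "?d = card S" by (auto dest: bij_betw_same_card)
  ultimately show "bij_betw (\<lambda>m. (p ^^ m) x) {..<card S} S" by (metis atLeast0LessThan)
  show "(p ^^ card S) x = x" using funpow_dist1_prop[OF x] by (simp only: d)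
qed

text \<open>Both cycles are listed from the same starting point \<open>x\<close>, and
  \<open>g\<close> matches equal positions.\<close>

lemma conj_if_cyc_eq_1:
  assumes fin: "finite S" and p: "p permutes S" "cyc S p = 1" and q: "q permutes S" "cyc S q = 1"
  obtains g where "g permutes S" "q = g \<circ> p \<circ> inv g"
proof (cases "S = {}")
  case True
  then show ?thesis using p q that[of id] by simp
next
  case False
  then obtain x where x: "x \<in> S" by blast
  note bp = funpow_bij_betw_if_cyc_eq_1[OF p(1) fin p(2) x]
  note bq = funpow_bij_betw_if_cyc_eq_1[OF q(1) fin q(2) x]
  let ?P = "\<lambda>m. (p ^^ m) x" and ?Q = "\<lambda>m. (q ^^ m) x"
  define h where "h = (\<lambda>y. ?Q (inv_into {..<card S} ?P y))"
  define g where "g = (\<lambda>y. if y \<in> S then h y else y)"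
  have "bij_betw h S S"
    using bij_betw_trans[OF bij_betw_inv_into[OF bp(1)] bq(1)] by (simp add: h_def comp_def)
  then have "bij_betw g S S" by (simp add: g_def cong: bij_betw_cong)
  then have g: "g permutes S" by (rule bij_imp_permutes) (simp add: g_def)
  have gP: "g (?P m) = ?Q m" if "m < card S" for m
  proof -
    have "?P m \<in> S" using that bp(1) by (auto simp: bij_betw_def)
    moreover have "inv_into {..<card S} ?P (?P m) = m"
      by (rule inv_into_f_f) (use that bp(1) in \<open>auto simp: bij_betw_def\<close>)
    ultimately show ?thesis by (simp only: g_def h_def if_True)
  qed
  have "g (p y) = q (g y)" for y
  proof (cases "y \<in> S")
    case True
    then obtain m where m: "m < card S" "y = ?P m" using bp(1) by (auto simp: bij_betw_def)
    show ?thesis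
    proof (cases "Suc m < card S")
      case True
      then show ?thesis using gP[of "Suc m"] gP[of m] m by simp
    next
      case False
      \<comment> \<open>At the last position both cycles return to \<open>x\<close>, which
        \<open>g\<close> fixes.\<close>
      then have "Suc m = card S" using m by simp
      then have "p y = x" "q (g y) = x" using bp(2) bq(2) m gP[of m] by (metis funpow.simps(2) comp_apply)+
      moreover have "g x = x" using gP[of 0] m by simp
      ultimately show ?thesis by simp
    qed
  next
    case False
    then show ?thesis using p(1) q(1) by (simp add: g_def permutes_not_in)
  qed
  then have "q \<circ> g = g \<circ> p" by (simp add: fun_eq_iff)
  then have "q \<circ> (g \<circ> inv g) = g \<circ> p \<circ> inv g" by (simp only: comp_assoc[symmetric])
  then have "q = g \<circ> p \<circ> inv g" by (simp add: permutes_inv_o[OF g])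
  with g show ?thesis by (rule that)
qed

context hook_shape
begin

text \<open>Row permutations fix \<open>J\<close> pointwise, so a product \<pi> \<circ> \<sigma>
  acts on \<open>J\<close> as \<pi> does. Conversely, a collision would put
  \<open>card J + 2\<close> distinct images into a column of \<open>card J + 1\<close>
  points.\<close>

lemma hook_nonzero_iff:
  assumes "\<beta> permutes S"
  shows "hook \<beta> \<noteq> 0 \<longleftrightarrow> \<beta> ` J \<subseteq> insert i J"
proof
  assume "hook \<beta> \<noteq> 0"
  then obtain \<pi> \<sigma> where *: "\<pi> permutes insert i J" "\<sigma> permutes S - J" "\<beta> = \<pi> \<circ> \<sigma>"
    by (rule hook_nonzero_factor)
  then have "\<beta> j = \<pi> j" if "j \<in> J" for j using that by (simp add: permutes_not_in)
  then show "\<beta> ` J \<subseteq> insert i J" using permutes_in_image[OF *(1)] by auto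
next
  assume sub: "\<beta> ` J \<subseteq> insert i J"
  show "hook \<beta> \<noteq> 0"
    using assms
  proof (cases rule: factor_or_collision)
    case (factor \<pi> \<sigma>)
    then show ?thesis by (simp add: hook_mult)
  next
    case (collision t t')
    have "t \<notin> J" "t' \<notin> J" "finite J" using collision fin_row_col(1) by auto
    then have "card (insert t (insert t' J)) = Suc (Suc (card J))" using collision by simp
    then have "card (\<beta> ` insert t (insert t' J)) = Suc (Suc (card J))"
      by (subst card_image[OF permutes_inj_on[OF assms]])
    moreover have "card (\<beta> ` insert t (insert t' J)) \<le> card (insert i J)"
      using collision sub fin_row_col(1) by (intro card_mono) auto
    moreover have "card (insert i J) \<le> Suc (card J)" by (rule card_insert_le_m1) auto
    ultimately show ?thesis by simp
  qed
qed

text \<open>The cycle numbers of the two factors add up to 2 and are positive, so the column factor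
  is a single cycle on \<open>card J + 1\<close> points. Its sign cancels the prefactor.\<close>

lemma hook_long_cycle:
  assumes "\<beta> permutes S" "cyc S \<beta> = 1"
  shows "(-1) ^ card J * hook \<beta> = (if \<beta> ` J \<subseteq> insert i J then 1 else 0)"
proof (cases "hook \<beta> = 0")
  case True
  then show ?thesis using hook_nonzero_iff[OF assms(1)] by simp
next
  case False
  then obtain \<pi> \<sigma> where *: "\<pi> permutes insert i J" "\<sigma> permutes S - J" "\<beta> = \<pi> \<circ> \<sigma>"
    by (rule hook_nonzero_factor)
  have "cyc (insert i J) \<pi> > 0" "cyc (S - J) \<sigma> > 0"
    using fin_row_col iS JS by (auto intro!: cyc_pos)
  then have "cyc (insert i J) \<pi> = 1" using cyc_factor[OF *(1,2)] assms(2) *(3) by simp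
  moreover have "card (insert i J) = Suc (card J)"
    using fin_row_col(1) JS by (subst card_insert_disjoint) auto
  ultimately have "hook \<beta> = (-1) ^ card J"
    using sign_eq_cyc[OF fin_row_col(1) *(1)] hook_mult[OF *(1,2)] *(3) by simp
  then show ?thesis using hook_nonzero_iff[OF assms(1)] False by (simp flip: power_add mult_2)
qed

text \<open>The cycle \<open>C\<close> belongs to the row factor. Moving it to the column factor
  gives a factorization for \<open>J \<union> C\<close>, and the sign changes by that of one cycle
  of length \<open>card C\<close>.\<close>

lemma hook_add_cycle:
  assumes \<beta>: "\<beta> permutes S" and nz: "\<beta> ` J \<subseteq> insert i J"
    and x: "x \<in> S" and C: "C = orbit \<beta> x" "C \<inter> insert i J = {}"
  shows "hook_shape.hook i S (J \<union> C) \<beta> = - ((-1) ^ card C * hook \<beta>)"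
proof -
  have CS: "C \<subseteq> S" unfolding C(1) by (rule permutes_orbit_subset[OF \<beta> x])
  interpret C: hook_shape i S "J \<union> C" by unfold_locales (use fin iS JS CS C(2) in auto)
  obtain \<pi> \<sigma> where *: "\<pi> permutes insert i J" "\<sigma> permutes S - J" "\<beta> = \<pi> \<circ> \<sigma>"
    using hook_nonzero_iff[OF \<beta>] nz hook_nonzero_factor by blast
  have \<sigma>C: "\<sigma> z = \<beta> z" "\<beta> z \<in> C" if "z \<in> C" for z
  proof -
    show \<beta>z: "\<beta> z \<in> C" using that unfolding C(1) by (rule orbit.step)
    have "\<sigma> z \<notin> insert i J"
    proof
      assume "\<sigma> z \<in> insert i J"
      then have "\<pi> (\<sigma> z) \<in> insert i J" using permutes_in_image[OF *(1)] by blast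
      then show False using \<beta>z *(3) C(2) by auto
    qed
    then show "\<sigma> z = \<beta> z" using permutes_not_in[OF *(1)] *(3) by simp
  qed
  have Ks: "C \<subseteq> S - J" "\<sigma> ` C \<subseteq> C" using CS C(2) \<sigma>C by auto
  note split = permutes_split_invariant[OF *(2) fin_row_col(2) Ks]
  let ?\<tau> = "perm_restrict \<sigma> C" and ?\<rho> = "perm_restrict \<sigma> (S - J - C)"
  \<comment> \<open>The two pieces act on disjoint sets; commuting them puts the cycle next to
    \<pi>.\<close>
  have comm: "?\<rho> \<circ> ?\<tau> = ?\<tau> \<circ> ?\<rho>"
  proof -
    have "?\<rho> \<circ> ?\<tau> = perm_restrict \<sigma> (S - J - C \<union> C)" "?\<tau> \<circ> ?\<rho> = perm_restrict \<sigma> (C \<union> (S - J - C))"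
      by (rule perm_restrict_union[OF split(2,1)], blast)
        (rule perm_restrict_union[OF split(1,2)], blast)
    then show ?thesis by (simp only: Un_commute)
  qed
  have \<pi>': "\<pi> \<circ> ?\<tau> permutes insert i (J \<union> C)"
    by (intro permutes_compose permutes_subset[OF split(1)] permutes_subset[OF *(1)]) auto
  have \<rho>': "?\<rho> permutes S - (J \<union> C)" using split(2) by (simp add: Diff_Diff_Int Diff_Un set_diff_eq Int_def conj_ac)
  have "C.hook \<beta> = sign (\<pi> \<circ> ?\<tau>)"
  proof -
    have "\<beta> = (\<pi> \<circ> ?\<tau>) \<circ> ?\<rho>" using *(3) split(3) comm by (metis comp_assoc)
    then show ?thesis using C.hook_mult[OF \<pi>' \<rho>'] by simp
  qed
  also have "\<dots> = sign \<pi> * sign ?\<tau>"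
    using *(1) split(1) fin_row_col CS fin
    by (intro sign_compose permutes_imp_permutation) (auto intro: finite_subset)
  also have "sign \<pi> = hook \<beta>" using hook_mult[OF *(1,2)] *(3) by simp
  also have "sign ?\<tau> = (-1) ^ (card C + cyc C ?\<tau>)"
    using split(1) CS fin by (intro sign_eq_cyc) (auto intro: finite_subset)
  also have "cyc C ?\<tau> = 1"
  proof -
    have "orbit ?\<tau> z = C" if "z \<in> C" for z
    proof -
      have o: "orbit \<beta> z = C"
        unfolding C(1) by (rule orbit_eq_if_mem[OF \<beta> fin that[unfolded C(1)]])
      have "orbit ?\<tau> z = orbit \<beta> z"
        using orbit_refl[OF \<beta> fin] by (rule orbit_cong) (simp add: o perm_restrict_simps \<sigma>C)
      then show ?thesis using o by simp
    qed
    then have "orbit ?\<tau> ` C = {C}" using orbit_refl[OF \<beta> fin, of x] C(1) by auto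
    then show ?thesis by (simp add: cyc_def)
  qed
  finally show ?thesis by simp
qed

end

text \<open>The sets in question are the final segments of the cycle \<open>p\<close>, written starting from \<open>i\<close>.\<close>

lemma card_closed_segments:
  assumes p: "p permutes S" and fin: "finite S" and c: "cyc S p = 1" and i: "i \<in> S"
  shows "card {J. J \<subseteq> S - {i} \<and> p ` J \<subseteq> insert i J} = card S"
proof -
  define N where "N = card S"
  define e where "e m = (p ^^ m) i" for m
  have bij: "bij_betw e {..<N} S" and eN: "e N = i"
    using funpow_bij_betw_if_cyc_eq_1[OF p fin c i] by (simp_all add: e_def[abs_def] N_def)
  have e0: "e 0 = i" and eS: "p (e m) = e (Suc m)" for m by (simp_all add: e_def)
  have N: "N > 0" using fin i by (auto simp: N_def card_gt_0_iff)
  have inj: "inj_on e {..<N}" using bij by (simp add: bij_betw_def)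
  have eq: "e m = e n \<longleftrightarrow> m = n" if "m < N" "n < N" for m n
    using inj that by (auto simp: inj_on_def)
  let ?J = "\<lambda>s. e ` {s..<N}"
  have "{J. J \<subseteq> S - {i} \<and> p ` J \<subseteq> insert i J} = ?J ` {1..N}"
  proof (intro set_eqI iffI)
    fix J assume "J \<in> ?J ` {1..N}"
    then obtain s where s: "s \<in> {1..N}" "J = ?J s" by blast
    have 1: "e m \<in> S - {i}" if "m \<in> {s..<N}" for m
      using that s bij eq[of m 0] N e0 by (auto simp: bij_betw_def)
    have 2: "p (e m) \<in> insert i (?J s)" if "m \<in> {s..<N}" for m
      using that s eN by (cases "Suc m = N") (auto simp: eS)
    have "?J s \<subseteq> S - {i}" by (rule image_subsetI) (rule 1)
    moreover have "p ` ?J s \<subseteq> insert i (?J s)"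
      unfolding image_image by (rule image_subsetI) (rule 2)
    ultimately show "J \<in> {J. J \<subseteq> S - {i} \<and> p ` J \<subseteq> insert i J}" using s(2) by simp
  next
    fix J assume "J \<in> {J. J \<subseteq> S - {i} \<and> p ` J \<subseteq> insert i J}"
    then have J: "J \<subseteq> S - {i}" "p ` J \<subseteq> insert i J" by auto
    \<comment> \<open>The alternative \<open>m = N\<close> provides a value for empty
      \<open>J\<close>, whose segment starts at N.\<close>
    have ex: "\<exists>m. m = N \<or> (m < N \<and> e m \<in> J)" by blast
    define s where "s = (LEAST m. m = N \<or> (m < N \<and> e m \<in> J))"
    have s: "s = N \<or> (s < N \<and> e s \<in> J)" unfolding s_def by (rule LeastI_ex[OF ex])
    have low: "m < s \<Longrightarrow> \<not> (m = N \<or> (m < N \<and> e m \<in> J))" for m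
      unfolding s_def by (rule not_less_Least)
    have up: "e m \<in> J" if "s \<le> m" "m < N" for m
      using that
    proof (induction rule: dec_induct)
      case base
      then show ?case using s by auto
    next
      case (step m)
      then have "e (Suc m) \<in> insert i J" using J(2) by (auto simp: eS[symmetric])
      moreover have "e (Suc m) \<noteq> i" using eq[of "Suc m" 0] step N by (simp add: e0)
      ultimately show ?case by simp
    qed
    have "J = ?J s"
    proof
      show "?J s \<subseteq> J" using up by auto
      show "J \<subseteq> ?J s"
      proof
        fix y assume y: "y \<in> J"
        then obtain m where m: "m < N" "y = e m" using J(1) bij by (auto simp: bij_betw_def)
        then have "\<not> m < s" using low y by blast
        then show "y \<in> ?J s" using m by auto
      qed
    qed
    moreover have "s \<ge> 1"
      using s J(1) e0 N by (cases s) auto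
    moreover have "s \<le> N" using s by auto
    ultimately show "J \<in> ?J ` {1..N}" by auto
  qed
  moreover have "inj_on ?J {1..N}"
  proof (rule inj_onI)
    fix s t assume st: "s \<in> {1..N}" "t \<in> {1..N}" "?J s = ?J t"
    have "card (?J u) = N - u" for u
      using inj by (subst card_image) (auto intro: inj_on_subset)
    then have "N - s = N - t" using st(3) by metis
    then show "s = t" using st by auto
  qed
  ultimately show ?thesis by (simp add: card_image N_def)
qed

text \<open>If \<open>\<beta>\<close> is not a long cycle, it has a cycle \<open>C\<close> that avoids \<open>i\<close>, and adding \<open>C\<close> to \<open>J\<close> reverses
  the sign of the summand.\<close>

lemma alternating_sum_hook:
  assumes \<beta>: "\<beta> permutes S" and fin: "finite S" and i: "i \<in> S"
  shows "(\<Sum>J\<in>Pow (S - {i}). (-1) ^ card J * hook_shape.hook i S J \<beta>) =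
    (if cyc S \<beta> = 1 then int (card S) else 0)"
proof -
  have shape: "hook_shape i S J" if "J \<subseteq> S - {i}" for J
    using that fin i by unfold_locales
  let ?f = "\<lambda>J. (-1) ^ card J * hook_shape.hook i S J \<beta>"
  let ?G = "{J. J \<subseteq> S - {i} \<and> \<beta> ` J \<subseteq> insert i J}"
  have finP: "finite (Pow (S - {i}))" using fin by simp
  show ?thesis
  proof (cases "cyc S \<beta> = 1")
    case True
    have "sum ?f (Pow (S - {i})) = (\<Sum>J\<in>Pow (S - {i}). if \<beta> ` J \<subseteq> insert i J then 1 else 0)"
      using hook_shape.hook_long_cycle[OF shape \<beta> True] by (intro sum.cong) auto
    also have "\<dots> = int (card ?G)"
      using finP by (simp add: sum.If_cases Int_def)
    finally show ?thesis using card_closed_segments[OF \<beta> fin True i] True by simp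
  next
    case False
    have "\<exists>x\<in>S. orbit \<beta> x \<noteq> orbit \<beta> i"
    proof (rule ccontr)
      assume "\<not> ?thesis"
      then have "orbit \<beta> ` S = (\<lambda>_. orbit \<beta> i) ` S" by (intro image_cong refl) blast
      also have "\<dots> = {orbit \<beta> i}" using i by (simp add: image_constant)
      finally have "orbit \<beta> ` S = {orbit \<beta> i}" .
      then show False using False by (simp add: cyc_def)
    qed
    then obtain x where x: "x \<in> S" "orbit \<beta> x \<noteq> orbit \<beta> i" by blast
    define C where "C = orbit \<beta> x"
    have CS: "C \<subseteq> S" unfolding C_def by (rule permutes_orbit_subset[OF \<beta> x(1)])
    have iC: "i \<notin> C" using orbit_eq_if_mem[OF \<beta> fin, of i x] x(2) by (auto simp: C_def)
    have xC: "x \<in> C" unfolding C_def by (rule orbit_refl[OF \<beta> fin])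
    have orbC: "orbit \<beta> z = C" if "z \<in> C" for z
      unfolding C_def by (rule orbit_eq_if_mem[OF \<beta> fin that[unfolded C_def]])
    \<comment> \<open>Such a \<open>J\<close> can be left only through \<open>i\<close>, which is
      not on \<open>C\<close>; so \<open>J\<close> contains \<open>C\<close> as soon as it meets
      it.\<close>
    have C_in: "C \<subseteq> J" if J: "J \<in> ?G" and z: "z \<in> C" "z \<in> J" for J z
    proof -
      have "y \<in> J" if "y \<in> orbit \<beta> z" for y
        using that
      proof induction
        case base
        have "\<beta> z \<in> C" using orbC[OF z(1)] orbit.base by metis
        then show ?case using J z iC by auto
      next
        case (step y)
        have "\<beta> y \<in> C" using orbC[OF z(1)] orbit.step[OF step.hyps] by simp
        then show ?case using J step.IH iC by auto
      qed
      then show ?thesis using orbC[OF z(1)] by auto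
    qed
    have \<beta>C: "\<beta> ` C \<subseteq> C" by (auto simp: C_def intro: orbit.step)
    have finG: "finite ?G" by (rule finite_subset[OF _ finP]) auto
    let ?without = "{J\<in>?G. x \<notin> J}" and ?with = "{J\<in>?G. x \<in> J}"
    have disj: "J \<inter> C = {}" if "J \<in> ?without" for J
      using C_in[of J] that xC by auto
    have "sum ?f (Pow (S - {i})) = sum ?f ?G"
    proof (rule sum.mono_neutral_right[OF finP], blast, rule ballI)
      fix J assume "J \<in> Pow (S - {i}) - ?G"
      then have "J \<subseteq> S - {i}" "\<not> \<beta> ` J \<subseteq> insert i J" by blast+
      then have "hook_shape.hook i S J \<beta> = 0" using hook_shape.hook_nonzero_iff[OF shape \<beta>] by metis
      then show "?f J = 0" by simp
    qed
    also have "\<dots> = sum ?f ?without + sum ?f ?with"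
      by (subst sum.union_disjoint[symmetric])
        (auto intro!: sum.cong intro: finite_subset[OF _ finG])
    also have "sum ?f ?with = sum (\<lambda>J. ?f (J \<union> C)) ?without"
    proof (rule sum.reindex_bij_witness[where j = "\<lambda>J. J - C" and i = "\<lambda>J. J \<union> C"])
      fix J assume J: "J \<in> ?with"
      then have CJ: "C \<subseteq> J" using C_in[of J x] xC by auto
      then show eq: "J - C \<union> C = J" by auto
      have "\<beta> z \<notin> C" if "z \<notin> C" for z
      proof
        assume "\<beta> z \<in> C"
        then have "orbit \<beta> (\<beta> z) = C" by (rule orbC)
        moreover have "\<beta> z \<in> orbit \<beta> z" by (rule orbit.base)
        ultimately have "orbit \<beta> z = C" using orbit_eq_if_mem[OF \<beta> fin] by metis
        then show False using orbit_refl[OF \<beta> fin, of z] that by simp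
      qed
      then show "J - C \<in> ?without" using J xC by auto
      show "?f (J - C \<union> C) = ?f J" by (simp only: eq)
    next
      fix J assume J: "J \<in> ?without"
      show "J \<union> C - C = J" using disj[OF J] by auto
      show "J \<union> C \<in> ?with" using J CS iC xC \<beta>C by auto
    qed
    also have "\<dots> = (\<Sum>J\<in>?without. - ?f J)"
    proof (rule sum.cong[OF refl])
      fix J assume J: "J \<in> ?without"
      have "hook_shape.hook i S (J \<union> C) \<beta> = - ((-1) ^ card C * hook_shape.hook i S J \<beta>)"
        using J disj[OF J] iC x by (intro hook_shape.hook_add_cycle[OF shape \<beta> _ x(1) C_def]) auto
      moreover have "card (J \<union> C) = card J + card C"
        using J disj[OF J] fin CS by (intro card_Un_disjoint) (auto intro: finite_subset)
      ultimately show "?f (J \<union> C) = - ?f J"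
        by (simp add: power_add flip: power_mult_distrib)
    qed
    finally show ?thesis using False by (simp add: sum_negf)
  qed
qed

subsection \<open>Factorizations of the long cycle\<close>

lemma sum_permutations_conj:
  assumes g: "g permutes S"
  shows "sum f {p. p permutes S} = (\<Sum>p | p permutes S. f (g \<circ> p \<circ> inv g))"
proof -
  have "sum f {p. p permutes S} = (\<Sum>p | p permutes S. f (g \<circ> p))"
    by (rule setum_permutations_compose_left[OF g])
  also have "\<dots> = (\<Sum>p | p permutes S. f (g \<circ> (p \<circ> inv g)))"
    by (rule sum_permutations_compose_right[OF permutes_inv[OF g]])
  finally show ?thesis by (simp only: comp_assoc)
qed

text \<open>Conjugating all three factors by \<open>g\<close> conjugates their product by
  \<open>g\<close>.\<close>

lemma sum_triples_conj_invariant: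
  fixes w :: "('a \<Rightarrow> 'a) \<Rightarrow> ('a \<Rightarrow> 'a) \<Rightarrow> ('a \<Rightarrow> 'a) \<Rightarrow> 'b::comm_monoid_add"
  assumes g: "g permutes S"
    and w: "\<And>a b c. a permutes S \<Longrightarrow> b permutes S \<Longrightarrow> c permutes S \<Longrightarrow>
      w (g \<circ> a \<circ> inv g) (g \<circ> b \<circ> inv g) (g \<circ> c \<circ> inv g) = w a b c"
  shows "(\<Sum>a | a permutes S. \<Sum>b | b permutes S. \<Sum>c | c permutes S.
      if a \<circ> b \<circ> c = g \<circ> \<gamma> \<circ> inv g then w a b c else 0) =
    (\<Sum>a | a permutes S. \<Sum>b | b permutes S. \<Sum>c | c permutes S.
      if a \<circ> b \<circ> c = \<gamma> then w a b c else 0)"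
proof -
  have eq: "(g \<circ> a \<circ> inv g) \<circ> (g \<circ> b \<circ> inv g) \<circ> (g \<circ> c \<circ> inv g) = g \<circ> \<gamma> \<circ> inv g \<longleftrightarrow> a \<circ> b \<circ> c = \<gamma>"
    for a b c
  proof -
    have "(g \<circ> a \<circ> inv g) \<circ> (g \<circ> b \<circ> inv g) \<circ> (g \<circ> c \<circ> inv g) =
        g \<circ> a \<circ> (inv g \<circ> g) \<circ> b \<circ> (inv g \<circ> g) \<circ> c \<circ> inv g"
      by (simp only: comp_assoc)
    also have "\<dots> = g \<circ> (a \<circ> b \<circ> c) \<circ> inv g" by (simp add: permutes_inv_o[OF g] comp_assoc)
    finally have 1: "(g \<circ> a \<circ> inv g) \<circ> (g \<circ> b \<circ> inv g) \<circ> (g \<circ> c \<circ> inv g) = g \<circ> (a \<circ> b \<circ> c) \<circ> inv g" .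
    have 2: "inv g \<circ> (g \<circ> p \<circ> inv g) \<circ> g = p" for p
    proof -
      have "inv g \<circ> (g \<circ> p \<circ> inv g) \<circ> g = (inv g \<circ> g) \<circ> p \<circ> (inv g \<circ> g)" by (simp only: comp_assoc)
      then show ?thesis by (simp add: permutes_inv_o[OF g])
    qed
    show ?thesis unfolding 1 using 2 by metis
  qed
  let ?F = "\<lambda>a b c. if a \<circ> b \<circ> c = g \<circ> \<gamma> \<circ> inv g then w a b c else 0"
  have "(\<Sum>a | a permutes S. \<Sum>b | b permutes S. \<Sum>c | c permutes S. ?F a b c) =
      (\<Sum>a | a permutes S. \<Sum>b | b permutes S. \<Sum>c | c permutes S.
        ?F (g \<circ> a \<circ> inv g) (g \<circ> b \<circ> inv g) (g \<circ> c \<circ> inv g))"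
    by (rule trans[OF sum_permutations_conj[OF g]], rule sum.cong[OF refl],
      rule trans[OF sum_permutations_conj[OF g]], rule sum.cong[OF refl],
      rule sum_permutations_conj[OF g])
  also have "\<dots> = (\<Sum>a | a permutes S. \<Sum>b | b permutes S. \<Sum>c | c permutes S.
      if a \<circ> b \<circ> c = \<gamma> then w a b c else 0)"
    unfolding eq by (intro sum.cong refl if_cong w) auto
  finally show ?thesis .
qed

text \<open>\<open>fact (Suc n)\<close> is the product of \<open>Suc n\<close>, the value of the
  alternating hook sum at a long cycle, and \<open>fact n\<close>, the number of long cycles. The
  binomial counts the sets \<open>J\<close> of size k, as only this size enters the scalars.\<close>

lemma sum_factorizations_long_cycle:
  fixes x y z :: "'b::{idom,ring_char_0}"
  assumes fin: "finite S" and N: "card S = Suc n" and \<gamma>: "\<gamma> permutes S" "cyc S \<gamma> = 1"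
    and nz: "x \<noteq> 0" "y \<noteq> 0" "z \<noteq> 0"
  shows "fact (Suc n) * (\<Sum>a | a permutes S. \<Sum>b | b permutes S. \<Sum>c | c permutes S.
      if a \<circ> b \<circ> c = \<gamma> then x ^ cyc S a * y ^ cyc S b * z ^ cyc S c else 0) =
    (\<Sum>k\<le>n. (-1) ^ k * of_nat (n choose k) * (pochhammer (x - of_nat k) (Suc n) *
      pochhammer (y - of_nat k) (Suc n) * pochhammer (z - of_nat k) (Suc n)))"
proof -
  obtain i where i: "i \<in> S" using N by fastforce
  let ?P = "{p. p permutes S}"
  have finP: "finite ?P" by (rule finite_permutations[OF fin])
  define w where "w a b c = x ^ cyc S a * y ^ cyc S b * z ^ cyc S c" for a b c
  define W where "W \<delta> = (\<Sum>a\<in>?P. \<Sum>b\<in>?P. \<Sum>c\<in>?P. if a \<circ> b \<circ> c = \<delta> then w a b c else 0)" for \<delta>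
  define L where "L = {\<delta>. \<delta> permutes S \<and> cyc S \<delta> = 1}"
  have finL: "finite L" by (rule finite_subset[OF _ finP]) (auto simp: L_def)
  have WL: "W \<delta> = W \<gamma>" if "\<delta> \<in> L" for \<delta>
  proof -
    have \<delta>: "\<delta> permutes S" "cyc S \<delta> = 1" using that by (auto simp: L_def)
    obtain g where g: "g permutes S" "\<delta> = g \<circ> \<gamma> \<circ> inv g"
      by (rule conj_if_cyc_eq_1[OF fin \<gamma> \<delta>])
    show ?thesis unfolding W_def g(2)
      by (rule sum_triples_conj_invariant[OF g(1)]) (simp add: w_def cyc_conj[OF _ g(1)])
  qed
  have cl: "t ^ cyc S (g \<circ> p \<circ> inv g) = t ^ cyc S p" if "g permutes S" "p permutes S" for t :: 'b and g p
    using cyc_conj[OF that(2,1)] by simp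
  \<comment> \<open>\<open>hook_eigen\<close> removes the leftmost factor of the product, so
    \<open>a\<close> is summed innermost, then \<open>b\<close>; for \<open>c\<close> only the
    eigenvalue is left.\<close>
  have lam: "(\<Sum>a\<in>?P. \<Sum>b\<in>?P. \<Sum>c\<in>?P. w a b c * of_int (hook_shape.hook i S J (a \<circ> b \<circ> c))) =
      pochhammer (x - of_nat (card J)) (Suc n) * pochhammer (y - of_nat (card J)) (Suc n) *
      pochhammer (z - of_nat (card J)) (Suc n)" if J: "J \<subseteq> S - {i}" for J
  proof -
    interpret hook_shape i S J using fin i J by unfold_locales
    let ?l = "\<lambda>t. pochhammer (t - of_nat (card J)) (Suc n)"
    have eig: "(\<Sum>a\<in>?P. t ^ cyc S a * of_int (hook (a \<circ> \<beta>))) = ?l t * of_int (hook \<beta>)"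
      if "\<beta> permutes S" "t \<noteq> 0" for \<beta> and t :: 'b
      using hook_eigen[of "\<lambda>a. t ^ cyc S a", OF cl that(1)] hook_eigenvalue[OF that(2)] N by simp
    have "(\<Sum>a\<in>?P. \<Sum>b\<in>?P. \<Sum>c\<in>?P. w a b c * of_int (hook (a \<circ> b \<circ> c))) =
        (\<Sum>c\<in>?P. z ^ cyc S c * (\<Sum>b\<in>?P. y ^ cyc S b * (\<Sum>a\<in>?P. x ^ cyc S a * of_int (hook (a \<circ> (b \<circ> c))))))"
    proof -
      have "(\<Sum>a\<in>?P. \<Sum>b\<in>?P. \<Sum>c\<in>?P. w a b c * of_int (hook (a \<circ> b \<circ> c))) =
          (\<Sum>a\<in>?P. \<Sum>c\<in>?P. \<Sum>b\<in>?P. w a b c * of_int (hook (a \<circ> b \<circ> c)))"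
        by (rule sum.cong[OF refl], rule sum.swap)
      also have "\<dots> = (\<Sum>c\<in>?P. \<Sum>a\<in>?P. \<Sum>b\<in>?P. w a b c * of_int (hook (a \<circ> b \<circ> c)))"
        by (rule sum.swap)
      also have "\<dots> = (\<Sum>c\<in>?P. \<Sum>b\<in>?P. \<Sum>a\<in>?P. w a b c * of_int (hook (a \<circ> b \<circ> c)))"
        by (rule sum.cong[OF refl], rule sum.swap)
      finally show ?thesis by (simp add: sum_distrib_left w_def comp_assoc mult_ac)
    qed
    also have "\<dots> = (\<Sum>c\<in>?P. z ^ cyc S c * (\<Sum>b\<in>?P. y ^ cyc S b * (?l x * of_int (hook (b \<circ> c)))))"
      using nz by (intro sum.cong refl arg_cong2[where f="(*)"] eig) (auto intro: permutes_compose)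
    also have "\<dots> = ?l x * (\<Sum>c\<in>?P. z ^ cyc S c * (\<Sum>b\<in>?P. y ^ cyc S b * of_int (hook (b \<circ> c))))"
      by (simp add: sum_distrib_left mult_ac)
    also have "\<dots> = ?l x * (\<Sum>c\<in>?P. z ^ cyc S c * (?l y * of_int (hook c)))"
      using nz by (intro sum.cong refl arg_cong2[where f="(*)"] eig) auto
    also have "\<dots> = ?l x * ?l y * (\<Sum>c\<in>?P. z ^ cyc S c * of_int (hook c))"
      by (simp add: sum_distrib_left mult_ac)
    also have "\<dots> = ?l x * ?l y * ?l z"
      using hook_eigenvalue[OF nz(3)] N by simp
    finally show ?thesis .
  qed
  have "card L = fact n"
    unfolding L_def using card_cyc_eq_1[OF fin] i N by auto
  then have "fact (Suc n) * W \<gamma> = of_nat (Suc n) * (of_nat (card L) * W \<gamma>)"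
    by (simp only: fact_Suc of_nat_mult of_nat_fact mult.assoc)
  also have "of_nat (card L) * W \<gamma> = (\<Sum>\<delta>\<in>L. W \<delta>)"
    using WL by simp
  also have "\<dots> = (\<Sum>a\<in>?P. \<Sum>b\<in>?P. \<Sum>c\<in>?P. \<Sum>\<delta>\<in>L. if a \<circ> b \<circ> c = \<delta> then w a b c else 0)"
    unfolding W_def
    by (rule trans[OF sum.swap], rule sum.cong[OF refl], rule trans[OF sum.swap],
      rule sum.cong[OF refl], rule sum.swap)
  also have "of_nat (Suc n) * \<dots> = (\<Sum>a\<in>?P. \<Sum>b\<in>?P. \<Sum>c\<in>?P. w a b c *
      of_int (\<Sum>J\<in>Pow (S - {i}). (-1) ^ card J * hook_shape.hook i S J (a \<circ> b \<circ> c)))"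
    unfolding sum_distrib_left
  proof (intro sum.cong refl)
    fix a b c assume abc: "a \<in> ?P" "b \<in> ?P" "c \<in> ?P"
    then have p: "a \<circ> b \<circ> c permutes S" by (auto intro: permutes_compose)
    have "(\<Sum>\<delta>\<in>L. of_nat (Suc n) * (if a \<circ> b \<circ> c = \<delta> then w a b c else 0)) =
        (\<Sum>\<delta>\<in>L. if a \<circ> b \<circ> c = \<delta> then of_nat (Suc n) * w a b c else 0)"
      by (intro sum.cong refl) auto
    also have "\<dots> = (if a \<circ> b \<circ> c \<in> L then of_nat (Suc n) * w a b c else 0)"
      using finL by simp
    also have "\<dots> = w a b c *
        of_int (\<Sum>J\<in>Pow (S - {i}). (-1) ^ card J * hook_shape.hook i S J (a \<circ> b \<circ> c))"
      unfolding alternating_sum_hook[OF p fin i] using p N by (auto simp: L_def)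
    finally show "(\<Sum>\<delta>\<in>L. of_nat (Suc n) * (if a \<circ> b \<circ> c = \<delta> then w a b c else 0)) = \<dots>" .
  qed
  also have "\<dots> = (\<Sum>J\<in>Pow (S - {i}). (-1) ^ card J *
      (\<Sum>a\<in>?P. \<Sum>b\<in>?P. \<Sum>c\<in>?P. w a b c * of_int (hook_shape.hook i S J (a \<circ> b \<circ> c))))"
  proof -
    have "(\<Sum>a\<in>?P. \<Sum>b\<in>?P. \<Sum>c\<in>?P. w a b c *
        of_int (\<Sum>J\<in>Pow (S - {i}). (-1) ^ card J * hook_shape.hook i S J (a \<circ> b \<circ> c))) =
      (\<Sum>a\<in>?P. \<Sum>b\<in>?P. \<Sum>c\<in>?P. \<Sum>J\<in>Pow (S - {i}).
        (-1) ^ card J * (w a b c * of_int (hook_shape.hook i S J (a \<circ> b \<circ> c))))"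
      by (intro sum.cong refl) (simp add: sum_distrib_left mult_ac)
    also have "\<dots> = (\<Sum>J\<in>Pow (S - {i}). \<Sum>a\<in>?P. \<Sum>b\<in>?P. \<Sum>c\<in>?P.
        (-1) ^ card J * (w a b c * of_int (hook_shape.hook i S J (a \<circ> b \<circ> c))))"
      by (rule sym, rule trans[OF sum.swap], rule sum.cong[OF refl], rule trans[OF sum.swap],
        rule sum.cong[OF refl], rule sum.swap)
    finally show ?thesis by (simp add: sum_distrib_left)
  qed
  also have "\<dots> = (\<Sum>J\<in>Pow (S - {i}). (-1) ^ card J *
      (pochhammer (x - of_nat (card J)) (Suc n) * pochhammer (y - of_nat (card J)) (Suc n) *
      pochhammer (z - of_nat (card J)) (Suc n)))"
    using lam by (intro sum.cong refl arg_cong2[where f="(*)"]) auto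
  also have "\<dots> = (\<Sum>k\<le>n. \<Sum>J | J \<in> Pow (S - {i}) \<and> card J = k. (-1) ^ card J *
      (pochhammer (x - of_nat (card J)) (Suc n) * pochhammer (y - of_nat (card J)) (Suc n) *
      pochhammer (z - of_nat (card J)) (Suc n)))"
  proof (rule sum.group[symmetric])
    have "card (S - {i}) = n" using N i fin by simp
    then show "card ` Pow (S - {i}) \<subseteq> {..n}" using fin by (auto intro: card_mono[THEN order_trans])
  qed (use fin in auto)
  also have "\<dots> = (\<Sum>k\<le>n. (-1) ^ k * of_nat (n choose k) * (pochhammer (x - of_nat k) (Suc n) *
      pochhammer (y - of_nat k) (Suc n) * pochhammer (z - of_nat k) (Suc n)))"
  proof (rule sum.cong[OF refl])
    fix k
    have "card {J. J \<subseteq> S - {i} \<and> card J = k} = n choose k"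
      using n_subsets[of "S - {i}" k] fin N i by simp
    then show "(\<Sum>J | J \<in> Pow (S - {i}) \<and> card J = k. (-1) ^ card J *
      (pochhammer (x - of_nat (card J)) (Suc n) * pochhammer (y - of_nat (card J)) (Suc n) *
      pochhammer (z - of_nat (card J)) (Suc n))) = (-1) ^ k * of_nat (n choose k) * (pochhammer (x - of_nat k) (Suc n) *
      pochhammer (y - of_nat k) (Suc n) * pochhammer (z - of_nat k) (Suc n))"
      by (simp add: mult_ac)
  qed
  finally show ?thesis unfolding W_def w_def .
qed

subsection \<open>Binomial identities\<close>

text \<open>Pascal's rule splits the binomial, and shifting the index in one part reverses its
  sign.\<close>

lemma alternating_sum_binomial_Suc:
  fixes g :: "nat \<Rightarrow> int"
  shows "(\<Sum>k\<le>Suc r. (-1) ^ k * int (Suc r choose k) * g k) =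
    (\<Sum>k\<le>r. (-1) ^ k * int (r choose k) * g k) - (\<Sum>k\<le>r. (-1) ^ k * int (r choose k) * g (Suc k))"
proof -
  have "(\<Sum>k\<le>Suc r. (-1) ^ k * int (Suc r choose k) * g k) =
      g 0 + (\<Sum>k\<le>r. (-1) ^ Suc k * int (r choose Suc k) * g (Suc k)) -
      (\<Sum>k\<le>r. (-1) ^ k * int (r choose k) * g (Suc k))"
    unfolding sum.atMost_Suc_shift by (simp add: algebra_simps sum.distrib sum_subtractf sum_negf)
  also have "g 0 + (\<Sum>k\<le>r. (-1) ^ Suc k * int (r choose Suc k) * g (Suc k)) =
      (\<Sum>k\<le>Suc r. (-1) ^ k * int (r choose k) * g k)"
    unfolding sum.atMost_Suc_shift by simp
  also have "\<dots> = (\<Sum>k\<le>r. (-1) ^ k * int (r choose k) * g k)" by simp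
  finally show ?thesis .
qed

text \<open>As functions of \<open>n\<close> and \<open>r\<close>, both sides satisfy
  \<open>f (Suc n) (Suc r) = f (Suc n) r - f n r\<close>; for \<open>r = 0\<close> the identity is Vandermonde's.\<close>

lemma alternating_sum_binomial_products:
  assumes "r \<le> n"
  shows "(\<Sum>k\<le>r. (-1) ^ k * int (r choose k) * (int ((n - k) choose s) * int ((n - k) choose t))) =
    (\<Sum>a\<le>n. if a + s \<le> n then int (((n - r) choose a) * (t choose (n - s - a)) * ((n - a) choose t)) else 0)"
  using assms
proof (induction r arbitrary: n)
  case 0
  have "int (n choose s) * int (n choose t) =
    (\<Sum>a\<le>n. if a + s \<le> n then int ((n choose a) * (t choose (n - s - a)) * ((n - a) choose t)) else 0)"
  proof (cases "s \<le> n \<and> t \<le> n")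
    case True
    define m where "m = n - s"
    have "(\<Sum>a\<le>n. if a + s \<le> n then int ((n choose a) * (t choose (n - s - a)) * ((n - a) choose t)) else 0) =
        (\<Sum>a\<le>m. int ((n choose a) * (t choose (m - a)) * ((n - a) choose t)))"
      using True by (intro sum.mono_neutral_cong_right) (auto simp: m_def)
    also have "\<dots> = (\<Sum>a\<le>m. int ((n choose t) * (((n - t) choose a) * (t choose (m - a)))))"
    proof (intro sum.cong refl arg_cong[of _ _ int])
      fix a assume "a \<in> {..m}"
      \<comment> \<open>Both sides count pairs of disjoint subsets of sizes \<open>a\<close> and
        \<open>t\<close>. They are compared through the union, of size \<open>a + t\<close>.\<close>
      have "(n choose a) * ((n - a) choose t) = (n choose t) * ((n - t) choose a)"
      proof (cases "a + t \<le> n")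
        case True
        have "(n choose (a + t)) * ((a + t) choose a) = (n choose a) * ((n - a) choose t)"
          using choose_mult[of a "a + t" n] True by simp
        moreover have "(n choose (a + t)) * ((a + t) choose t) = (n choose t) * ((n - t) choose a)"
          using choose_mult[of t "a + t" n] True by simp
        moreover have "(a + t) choose a = (a + t) choose t"
          using binomial_symmetric[of a "a + t"] by simp
        ultimately show ?thesis by simp
      next
        case False
        then have "n - a < t" "n - t < a"
          using \<open>s \<le> n \<and> t \<le> n\<close> \<open>a \<in> {..m}\<close> by (auto simp: m_def)
        then show ?thesis by (simp add: binomial_eq_0)
      qed
      then have "(n choose a) * ((n - a) choose t) * (t choose (m - a)) =
          (n choose t) * ((n - t) choose a) * (t choose (m - a))" by simp
      then show "(n choose a) * (t choose (m - a)) * ((n - a) choose t) =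
          (n choose t) * (((n - t) choose a) * (t choose (m - a)))"
        by (simp only: mult_ac)
    qed
    also have "\<dots> = int ((n choose t) * (n choose m))"
      unfolding of_nat_sum[symmetric] sum_distrib_left[symmetric] vandermonde using True by simp
    also have "n choose m = n choose s" using True by (simp add: m_def binomial_symmetric[of s n])
    finally show ?thesis by simp
  next
    case False
    then have "(\<Sum>a\<le>n. if a + s \<le> n then int ((n choose a) * (t choose (n - s - a)) * ((n - a) choose t)) else 0) = 0"
      by (intro sum.neutral ballI) (auto simp: binomial_eq_0)
    moreover have "int (n choose s) * int (n choose t) = 0"
      using False by (auto simp: binomial_eq_0)
    ultimately show ?thesis by simp
  qed
  then show ?case unfolding diff_zero by simp
next
  case (Suc r)
  then obtain m where n: "n = Suc m" "r \<le> m" by (cases n) auto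
  let ?R = "\<lambda>n r a. if a + s \<le> n then int (((n - r) choose a) * (t choose (n - s - a)) * ((n - a) choose t)) else 0"
  \<comment> \<open>Pascal's rule in the binomial \<open>(n - r) choose a\<close>; lowering
    \<open>a\<close> and \<open>n\<close> together leaves the other two binomials unchanged.\<close>
  have step: "?R n r a - ?R n (Suc r) a = (case a of 0 \<Rightarrow> 0 | Suc b \<Rightarrow> ?R m r b)" for a
  proof (cases a)
    case (Suc b)
    have "Suc m - r = Suc (m - r)" using n by simp
    then show ?thesis using Suc by (auto simp: n algebra_simps)
  qed (simp add: n)
  have shift: "n - Suc k = m - k" for k by (simp add: n)
  have "(\<Sum>k\<le>Suc r. (-1) ^ k * int (Suc r choose k) * (int ((n - k) choose s) * int ((n - k) choose t))) =
      (\<Sum>a\<le>n. ?R n r a) - (\<Sum>a\<le>m. ?R m r a)"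
    unfolding alternating_sum_binomial_Suc shift Suc.IH[OF Suc_leD[OF Suc.prems]] Suc.IH[OF n(2)] ..
  also have "(\<Sum>a\<le>m. ?R m r a) = (\<Sum>a\<le>Suc m. case a of 0 \<Rightarrow> 0 | Suc b \<Rightarrow> ?R m r b)"
    unfolding sum.atMost_Suc_shift by simp
  also have "\<dots> = (\<Sum>a\<le>n. ?R n r a - ?R n (Suc r) a)"
    by (simp only: step n(1)[symmetric])
  finally show ?case by (simp add: sum_subtractf)
qed

section \<open>Shifted rising factorials in the binomial basis\<close>

lemma pochhammer_minus_of_nat:
  "pochhammer (- of_nat m :: 'b::comm_ring_1) q = (-1) ^ q * of_nat (fact q * (m choose q))"
proof (induction q)
  case (Suc q)
  have *: "of_nat (fact (Suc q) * (m choose Suc q)) = (of_nat (fact q * (m choose q)) :: 'b) * (of_nat m - of_nat q)"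
  proof (cases "q \<le> m")
    case True
    have "Suc q * (m choose Suc q) = (m choose q) * (m - q)"
      using binomial_absorption[of q m] binomial_absorb_comp[of m q] by (simp add: mult.commute)
    then have "fact (Suc q) * (m choose Suc q) = fact q * (m choose q) * (m - q)"
      by (simp only: fact_Suc of_nat_id mult_ac)
    then show ?thesis using True by (simp only: of_nat_mult of_nat_diff)
  qed (simp add: binomial_eq_0)
  show ?case
    by (simp only: pochhammer_Suc Suc.IH power_Suc *) (simp add: algebra_simps)
qed simp

lemma Const_mult [simp]: "Const a * Const b = Const (a * b)"
  by (simp add: Const_def)

lemma of_nat_eq_Const: "of_nat n = Const (of_nat n)"
  by (simp add: Const_def of_nat_poly)

lemma poly_binom_pochhammer: "poly_binom x p = Const (1 / fact p) * ((-1) ^ p * pochhammer (- x) p)"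
proof -
  have "(\<Prod>i<p. x - of_nat i) = (-1) ^ p * pochhammer (- x) p"
    by (induction p) (auto simp: pochhammer_Suc algebra_simps)
  then show ?thesis by (simp add: poly_binom_def)
qed

text \<open>The left side is C(x+n-k, n+1), and the expansion is Vandermonde's. Negating the
  arguments turns falling into rising factorials, to which the binomial theorem
  \<open>pochhammer_binomial_sum\<close> applies.\<close>

lemma pochhammer_eq_sum_poly_binom:
  assumes "k \<le> n"
  shows "Const (1 / fact (Suc n)) * pochhammer (x - of_nat k) (Suc n) =
    (\<Sum>p\<le>Suc n. poly_binom x p * of_nat ((n - k) choose (Suc n - p)))"
proof -
  let ?N = "Suc n"
  \<comment> \<open>The product is reread downwards from its largest factor
    \<open>x + of_nat (n - k)\<close>.\<close>
  have "x - of_nat k = (x + of_nat (n - k)) - of_nat ?N + 1"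
    using assms by (simp add: of_nat_diff)
  then have "pochhammer (x - of_nat k) ?N = (-1) ^ ?N * pochhammer (- x + - of_nat (n - k)) ?N"
    by (simp only: pochhammer_minus' minus_add_distrib)
  also have "\<dots> = (\<Sum>p\<le>?N. (-1) ^ ?N * (of_nat (?N choose p) * pochhammer (- x) p *
      ((-1) ^ (?N - p) * of_nat (fact (?N - p) * ((n - k) choose (?N - p))))))"
    unfolding pochhammer_binomial_sum pochhammer_minus_of_nat sum_distrib_left ..
  finally have poch: "pochhammer (x - of_nat k) ?N = \<dots>" .
  show ?thesis
    unfolding poch sum_distrib_left
  proof (rule sum.cong[OF refl])
    fix p assume "p \<in> {..?N}"
    then have p: "p \<le> ?N" by simp
    obtain d where d: "?N = p + d" using p le_Suc_ex by blast
    have sgn: "((-1) ^ ?N :: rat_poly3) * (-1) ^ (?N - p) = (-1) ^ p"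
      unfolding d by (simp add: power_add mult.assoc flip: power_mult_distrib)
    have "of_nat (?N choose p) = (fact ?N / (fact p * fact (?N - p)) :: rat)"
      using p by (rule binomial_fact)
    then have "1 / fact ?N * (of_nat (?N choose p) * fact (?N - p)) = (1 / fact p :: rat)"
      by (simp del: fact_Suc)
    then have c: "Const (1 / fact ?N) * (of_nat (?N choose p) * of_nat (fact (?N - p))) = Const (1 / fact p)"
      by (simp only: of_nat_eq_Const Const_mult of_nat_fact)
    have "Const (1 / fact ?N) * ((-1) ^ ?N * (of_nat (?N choose p) * pochhammer (- x) p *
        ((-1) ^ (?N - p) * of_nat (fact (?N - p) * ((n - k) choose (?N - p)))))) =
        (Const (1 / fact ?N) * (of_nat (?N choose p) * of_nat (fact (?N - p)))) *
        (((-1) ^ ?N * (-1) ^ (?N - p)) * pochhammer (- x) p) * of_nat ((n - k) choose (?N - p))"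
      by (simp only: of_nat_mult mult_ac)
    then show "Const (1 / fact ?N) * ((-1) ^ ?N * (of_nat (?N choose p) * pochhammer (- x) p *
        ((-1) ^ (?N - p) * of_nat (fact (?N - p) * ((n - k) choose (?N - p)))))) =
        poly_binom x p * of_nat ((n - k) choose (?N - p))"
      by (simp only: sgn c poly_binom_pochhammer)
  qed
qed

section \<open>The long cycle and the two sides of the identity\<close>

lemma long_cycle_permutes: "long_cycle N permutes {1..N}"
  using cycle_permutes[of "[1..<Suc N]"] by (simp add: long_cycle_def atLeastLessThanSuc_atLeastAtMost del: upt_Suc)

lemma cyc_long_cycle:
  assumes "N \<ge> 1"
  shows "cyc {1..N} (long_cycle N) = 1"
proof -
  have fin: "finite {1..N}" by simp
  have *: "orbit (long_cycle N) m = orbit (long_cycle N) 1" if "1 \<le> m" "m \<le> N" for m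
    using that
  proof (induction m rule: dec_induct)
    case (step m)
    have "Suc m \<in> orbit (long_cycle N) m"
      using orbit.base[of "long_cycle N" m] step by (simp add: long_cycle_apply)
    then have "orbit (long_cycle N) (Suc m) = orbit (long_cycle N) m"
      by (rule orbit_eq_if_mem[OF long_cycle_permutes fin])
    then show ?case using step by simp
  qed simp
  have "orbit (long_cycle N) ` {1..N} = (\<lambda>_. orbit (long_cycle N) 1) ` {1..N}"
    by (intro image_cong refl *) auto
  then show ?thesis using assms by (simp add: cyc_def image_constant_conv)
qed

lemma sum_pos3_eq:
  assumes "\<And>i j k. f i j k \<noteq> 0 \<Longrightarrow> 1 \<le> i \<Longrightarrow> 1 \<le> j \<Longrightarrow> 1 \<le> k \<Longrightarrow> i \<le> N \<and> j \<le> N \<and> k \<le> N"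
  shows "sum_pos3 f = (\<Sum>(i, j, k)\<in>{1..N} \<times> {1..N} \<times> {1..N}. f i j k)"
proof -
  have "sum_pos3 f = (\<Sum>(i, j, k)\<in>{1..N} \<times> {1..N} \<times> {1..N}. if 1 \<le> i \<and> 1 \<le> j \<and> 1 \<le> k then f i j k else 0)"
    unfolding sum_pos3_def
    by (rule Sum_any.expand_superset) (use assms in \<open>auto split: if_splits\<close>)
  also have "\<dots> = (\<Sum>(i, j, k)\<in>{1..N} \<times> {1..N} \<times> {1..N}. f i j k)"
    by (rule sum.cong) auto
  finally show ?thesis .
qed

lemma int_binom_of_nat [simp]: "int_binom (int n) (int k) = int (n choose k)"
  by (simp add: int_binom_def)

definition coefficient :: "nat \<Rightarrow> nat \<Rightarrow> nat \<Rightarrow> nat \<Rightarrow> int" where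
  "coefficient N p1 p2 p3 = int_binom (int N - 1) (int p3 - 1) *
     Sum_any (\<lambda>a. int_binom (int N - int p2) (int p1 - 1 - int a) *
                   int_binom (int N - int p3) (int a) *
                   int_binom (int N - 1 - int a) (int N - int p2))"

text \<open>The bound on \<open>p1\<close> combines two binomials: p1-1-a is at most N-p2, which is
  at most N-1-a.\<close>

lemma coefficient_nonzero:
  assumes "coefficient N p1 p2 p3 \<noteq> 0"
  shows "p1 \<le> N \<and> p2 \<le> N \<and> p3 \<le> N"
proof -
  from assms obtain a where "int_binom (int N - int p2) (int p1 - 1 - int a) *
      int_binom (int N - int p3) (int a) * int_binom (int N - 1 - int a) (int N - int p2) \<noteq> 0"
    unfolding coefficient_def by (auto elim: Sum_any.not_neutral_obtains_not_neutral)
  then show ?thesis by (auto simp: int_binom_def split: if_splits)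
qed

text \<open>The right side is symmetric in the three indices. With r = p3-1, two of its binomials
  are traded for C(n,r) C(r,k); the remaining sum over k up to r is evaluated by
  \<open>alternating_sum_binomial_products\<close>.\<close>

lemma coefficient_eq_alternating_sum:
  assumes "p1 \<in> {1..Suc n}" "p2 \<in> {1..Suc n}" "p3 \<in> {1..Suc n}"
  shows "coefficient (Suc n) p1 p2 p3 = (\<Sum>k\<le>n. (-1) ^ k * int (n choose k) *
    (int ((n - k) choose (Suc n - p1)) * int ((n - k) choose (Suc n - p2)) * int ((n - k) choose (Suc n - p3))))"
proof -
  define r s t where rst: "r = p3 - 1" "s = Suc n - p1" "t = Suc n - p2"
  have p: "p1 = Suc (n - s)" "int (Suc n) - int p2 = int t" "int p3 - 1 = int r" "p3 = Suc r"
    "int (Suc n) - int p3 = int (n - r)" "Suc n - p3 = n - r" "r \<le> n" "s \<le> n"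
    using assms by (auto simp: rst)
  have "Sum_any (\<lambda>a. int_binom (int (Suc n) - int p2) (int p1 - 1 - int a) *
        int_binom (int (Suc n) - int p3) (int a) *
        int_binom (int (Suc n) - 1 - int a) (int (Suc n) - int p2)) =
      (\<Sum>a\<le>n. int_binom (int t) (int (n - s) - int a) * int (n - r choose a) * int_binom (int n - int a) (int t))"
    unfolding p(2,5) int_binom_of_nat
    by (subst Sum_any.expand_superset[where A = "{..n}"])
      (auto simp: int_binom_def p(1) p(8) of_nat_diff split: if_splits)
  also have "\<dots> = (\<Sum>a\<le>n. if a + s \<le> n then int (((n - r) choose a) * (t choose (n - s - a)) * ((n - a) choose t)) else 0)"
  proof (intro sum.cong refl)
    fix a assume a: "a \<in> {..n}"
    show "int_binom (int t) (int (n - s) - int a) * int (n - r choose a) * int_binom (int n - int a) (int t) =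
      (if a + s \<le> n then int (((n - r) choose a) * (t choose (n - s - a)) * ((n - a) choose t)) else 0)"
    proof (cases "a + s \<le> n")
      case True
      then have "int (n - s) - int a = int (n - s - a)" "int n - int a = int (n - a)" by auto
      then show ?thesis using True by (simp only: int_binom_of_nat) simp
    next
      case False
      then show ?thesis using p(8) by (simp add: int_binom_def of_nat_diff)
    qed
  qed
  also have "\<dots> = (\<Sum>k\<le>r. (-1) ^ k * int (r choose k) * (int ((n - k) choose s) * int ((n - k) choose t)))"
    by (rule alternating_sum_binomial_products[OF p(7), symmetric])
  also have "\<dots> = (\<Sum>k\<le>n. (-1) ^ k * int (r choose k) * (int ((n - k) choose s) * int ((n - k) choose t)))"
    using p(7) by (intro sum.mono_neutral_left) auto
  finally have "coefficient (Suc n) p1 p2 p3 = int (n choose r) *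
      (\<Sum>k\<le>n. (-1) ^ k * int (r choose k) * (int ((n - k) choose s) * int ((n - k) choose t)))"
    by (simp add: coefficient_def p(3))
  also have "\<dots> = (\<Sum>k\<le>n. (-1) ^ k * int (n choose k) *
    (int ((n - k) choose s) * int ((n - k) choose t) * int ((n - k) choose (n - r))))"
    unfolding sum_distrib_left
  proof (intro sum.cong refl)
    fix k assume k: "k \<in> {..n}"
    \<comment> \<open>Trinomial revision: both sides count chains of a k-set inside an r-set inside
      an n-set.\<close>
    have "(n choose r) * (r choose k) = (n choose k) * ((n - k) choose (n - r))"
    proof (cases "k \<le> r")
      case True
      then show ?thesis
        using choose_mult[of k r n] p(7) binomial_symmetric[of "r - k" "n - k"] by simp
    next
      case False
      then have "n - k < n - r" using k by auto
      then show ?thesis using False by (simp add: binomial_eq_0)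
    qed
    then have "int (n choose r) * int (r choose k) = int (n choose k) * int ((n - k) choose (n - r))"
      by (simp flip: of_nat_mult)
    then show "int (n choose r) * ((-1) ^ k * int (r choose k) * (int ((n - k) choose s) * int ((n - k) choose t))) =
      (-1) ^ k * int (n choose k) * (int ((n - k) choose s) * int ((n - k) choose t) * int ((n - k) choose (n - r)))"
      by (simp add: mult_ac)
  qed
  finally show ?thesis unfolding rst(2,3) p(6) .
qed

lemma sum_product_triple:
  fixes f :: "'a \<Rightarrow> 'd::comm_semiring_0" and g :: "'b \<Rightarrow> 'd" and h :: "'c \<Rightarrow> 'd"
  shows "sum f A * sum g B * sum h C = (\<Sum>(i, j, k)\<in>A \<times> B \<times> C. f i * g j * h k)"
proof -
  have "sum f A * sum g B * sum h C = (\<Sum>i\<in>A. \<Sum>j\<in>B. f i * g j * sum h C)"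
    by (subst sum_product) (simp only: sum_distrib_right)
  then show ?thesis by (simp add: sum_distrib_left flip: sum.cartesian_product)
qed

text \<open>Factorizations are grouped by their triple of cycle numbers; these lie between 1 and N,
  so the box misses none.\<close>

lemma M_generating_function:
  fixes x y z :: rat_poly3
  assumes "N \<ge> 1"
  shows "(\<Sum>(i, j, k)\<in>{1..N} \<times> {1..N} \<times> {1..N}. of_nat (M i j k N) * (x ^ i * y ^ j * z ^ k)) =
    (\<Sum>a | a permutes {1..N}. \<Sum>b | b permutes {1..N}. \<Sum>c | c permutes {1..N}.
      if a \<circ> b \<circ> c = long_cycle N then x ^ cyc {1..N} a * y ^ cyc {1..N} b * z ^ cyc {1..N} c else 0)"
proof -
  let ?P = "{p. p permutes {1..N}}"
  define F where "F = {(a, b, c). a \<in> ?P \<and> b \<in> ?P \<and> c \<in> ?P \<and> a \<circ> b \<circ> c = long_cycle N}"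
  define h where "h = (\<lambda>(a, b, c). (num_cycles N a, num_cycles N b, num_cycles N c))"
  define w where "w = (\<lambda>(a, b, c). x ^ cyc {1..N} a * y ^ cyc {1..N} b * z ^ cyc {1..N} c)"
  have finP: "finite ?P" by (rule finite_permutations) simp
  have finF: "finite F"
    by (rule finite_subset[of _ "?P \<times> ?P \<times> ?P"]) (use finP in \<open>auto simp: F_def\<close>)
  have nc: "num_cycles N p = cyc {1..N} p" for p by (simp add: num_cycles_def cyc_def)
  have "num_cycles N p \<in> {1..N}" for p
    using cyc_pos[of "{1..N}" p] assms card_image_le[of "{1..N}" "orbit p"] by (auto simp: nc cyc_def)
  then have hF: "h ` F \<subseteq> {1..N} \<times> {1..N} \<times> {1..N}" by (auto simp: h_def)
  have "(\<Sum>(i, j, k)\<in>{1..N} \<times> {1..N} \<times> {1..N}. of_nat (M i j k N) * (x ^ i * y ^ j * z ^ k)) =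
      (\<Sum>t\<in>{1..N} \<times> {1..N} \<times> {1..N}. \<Sum>s | s \<in> F \<and> h s = t. w s)"
  proof (rule sum.cong[OF refl])
    fix t assume "t \<in> {1..N} \<times> {1..N} \<times> {1..N}"
    obtain i j k where t: "t = (i, j, k)" by (cases t)
    have "factorizations i j k N = {s \<in> F. h s = t}"
      by (auto simp: factorizations_def F_def h_def t)
    moreover have "w s = x ^ i * y ^ j * z ^ k" if "h s = t" for s
      using that by (auto simp: w_def h_def t nc split: prod.splits)
    ultimately show "(case t of (i, j, k) \<Rightarrow> of_nat (M i j k N) * (x ^ i * y ^ j * z ^ k)) =
        (\<Sum>s | s \<in> F \<and> h s = t. w s)"
      by (simp add: t M_def)
  qed
  also have "\<dots> = sum w F" using finF hF by (intro sum.group) auto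
  also have "\<dots> = (\<Sum>s\<in>?P \<times> ?P \<times> ?P. case s of (a, b, c) \<Rightarrow> if a \<circ> b \<circ> c = long_cycle N then w (a, b, c) else 0)"
    using finP by (intro sum.mono_neutral_cong_left) (auto simp: F_def split: if_splits)
  also have "\<dots> = (\<Sum>a\<in>?P. \<Sum>b\<in>?P. \<Sum>c\<in>?P. if a \<circ> b \<circ> c = long_cycle N then w (a, b, c) else 0)"
    by (simp flip: sum.cartesian_product)
  finally show ?thesis unfolding w_def prod.case .
qed

theorem theorem1:
  fixes N :: nat
  assumes "N \<ge> 1"
  shows "sum_pos3 (\<lambda>n1 n2 n3.
           Const (of_nat (M n1 n2 n3 N) / (fact N)\<^sup>2) * X1 ^ n1 * X2 ^ n2 * X3 ^ n3) =
         sum_pos3 (\<lambda>p1 p2 p3.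
           poly_binom X1 p1 * poly_binom X2 p2 * poly_binom X3 p3 *
           of_int (int_binom (int N - 1) (int p3 - 1) *
             Sum_any (\<lambda>a. int_binom (int N - int p2) (int p1 - 1 - int a) *
                           int_binom (int N - int p3) (int a) *
                           int_binom (int N - 1 - int a) (int N - int p2))))"
proof -
  obtain n where N: "N = Suc n" using assms by (cases N) auto
  let ?T = "{1..N} \<times> {1..N} \<times> {1..N}"
  define W where "W = (\<Sum>a | a permutes {1..N}. \<Sum>b | b permutes {1..N}. \<Sum>c | c permutes {1..N}.
      if a \<circ> b \<circ> c = long_cycle N then X1 ^ cyc {1..N} a * X2 ^ cyc {1..N} b * X3 ^ cyc {1..N} c else 0)"
  have M0: "n1 \<le> N \<and> n2 \<le> N \<and> n3 \<le> N" if "M n1 n2 n3 N \<noteq> 0" for n1 n2 n3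
  proof -
    have "num_cycles N p \<le> N" for p
      using card_image_le[of "{1..N}" "orbit p"] by (simp add: num_cycles_def)
    moreover have "factorizations n1 n2 n3 N \<noteq> {}" using that by (auto simp: M_def)
    ultimately show ?thesis by (auto simp: factorizations_def)
  qed
  have Const0: "Const 0 = 0" by (simp add: Const_def)
  have X: "X1 \<noteq> 0" "X2 \<noteq> 0" "X3 \<noteq> 0" by (simp_all add: X1_def X2_def X3_def)
  have "sum_pos3 (\<lambda>n1 n2 n3. Const (of_nat (M n1 n2 n3 N) / (fact N)\<^sup>2) * X1 ^ n1 * X2 ^ n2 * X3 ^ n3) =
      (\<Sum>(n1, n2, n3)\<in>?T. Const (of_nat (M n1 n2 n3 N) / (fact N)\<^sup>2) * X1 ^ n1 * X2 ^ n2 * X3 ^ n3)"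
    by (intro sum_pos3_eq M0 notI) (simp add: Const0)
  also have "\<dots> = (\<Sum>(n1, n2, n3)\<in>?T. Const (1 / (fact N)\<^sup>2) * (of_nat (M n1 n2 n3 N) * (X1 ^ n1 * X2 ^ n2 * X3 ^ n3)))"
    by (intro sum.cong refl) (auto simp: of_nat_eq_Const mult.assoc[symmetric])
  also have "\<dots> = Const (1 / (fact N)\<^sup>2) * W"
    unfolding W_def M_generating_function[OF assms, symmetric] by (simp add: sum_distrib_left case_prod_unfold)
  \<comment> \<open>One factor 1/N! is reserved for each variable; the N! that this costs is the one
    of \<open>sum_factorizations_long_cycle\<close>.\<close>
  also have "\<dots> = Const (1 / fact N) ^ 3 * (fact N * W)"
  proof -
    have "(fact N :: rat_poly3) = Const (fact N)" by (metis of_nat_eq_Const of_nat_fact)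
    then show ?thesis
      by (simp add: power3_eq_cube mult.assoc[symmetric] power2_eq_square del: fact_Suc)
  qed
  also have "fact N * W = (\<Sum>k\<le>n. (-1) ^ k * of_nat (n choose k) *
      (pochhammer (X1 - of_nat k) N * pochhammer (X2 - of_nat k) N * pochhammer (X3 - of_nat k) N))"
    using sum_factorizations_long_cycle[OF _ _ long_cycle_permutes cyc_long_cycle X, of N n] assms
    unfolding W_def N by simp
  also have "Const (1 / fact N) ^ 3 * \<dots> = (\<Sum>k\<le>n. (-1) ^ k * of_nat (n choose k) *
      ((Const (1 / fact N) * pochhammer (X1 - of_nat k) N) * (Const (1 / fact N) * pochhammer (X2 - of_nat k) N) *
      (Const (1 / fact N) * pochhammer (X3 - of_nat k) N)))"
    unfolding sum_distrib_left power3_eq_cube by (intro sum.cong refl) (simp only: mult_ac)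
  also have "\<dots> = (\<Sum>k\<le>n. (-1) ^ k * of_nat (n choose k) * (\<Sum>(p1, p2, p3)\<in>?T.
      (poly_binom X1 p1 * of_nat ((n - k) choose (N - p1))) * (poly_binom X2 p2 * of_nat ((n - k) choose (N - p2))) *
      (poly_binom X3 p3 * of_nat ((n - k) choose (N - p3)))))"
  proof (intro sum.cong refl arg_cong2[where f = "(*)"])
    fix k assume "k \<in> {..n}"
    then have "Const (1 / fact N) * pochhammer (x - of_nat k) N =
        (\<Sum>p\<le>N. poly_binom x p * of_nat ((n - k) choose (N - p)))" for x
      unfolding N by (intro pochhammer_eq_sum_poly_binom) simp
    \<comment> \<open>The term p = 0 vanishes because n-k is less than N.\<close>
    also have "(\<Sum>p\<le>N. poly_binom x p * of_nat ((n - k) choose (N - p))) =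
        (\<Sum>p\<in>{1..N}. poly_binom x p * of_nat ((n - k) choose (N - p)))" for x
      by (intro sum.mono_neutral_right) (auto simp: N not_le)
    finally show "Const (1 / fact N) * pochhammer (X1 - of_nat k) N * (Const (1 / fact N) * pochhammer (X2 - of_nat k) N) *
        (Const (1 / fact N) * pochhammer (X3 - of_nat k) N) = (\<Sum>(p1, p2, p3)\<in>?T.
        (poly_binom X1 p1 * of_nat ((n - k) choose (N - p1))) * (poly_binom X2 p2 * of_nat ((n - k) choose (N - p2))) *
        (poly_binom X3 p3 * of_nat ((n - k) choose (N - p3))))"
      by (simp only: sum_product_triple)
  qed
  also have "\<dots> = (\<Sum>(p1, p2, p3)\<in>?T. poly_binom X1 p1 * poly_binom X2 p2 * poly_binom X3 p3 *
      of_int (coefficient N p1 p2 p3))"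
    unfolding sum_distrib_left
  proof (subst sum.swap, rule sum.cong[OF refl])
    fix t assume "t \<in> ?T"
    then obtain p1 p2 p3 where t: "t = (p1, p2, p3)" "p1 \<in> {1..Suc n}" "p2 \<in> {1..Suc n}" "p3 \<in> {1..Suc n}"
      by (auto simp: N)
    show "(\<Sum>k\<le>n. (-1) ^ k * of_nat (n choose k) * (case t of (p1, p2, p3) \<Rightarrow>
        (poly_binom X1 p1 * of_nat ((n - k) choose (N - p1))) * (poly_binom X2 p2 * of_nat ((n - k) choose (N - p2))) *
        (poly_binom X3 p3 * of_nat ((n - k) choose (N - p3))))) = (case t of (p1, p2, p3) \<Rightarrow>
        poly_binom X1 p1 * poly_binom X2 p2 * poly_binom X3 p3 * of_int (coefficient N p1 p2 p3))"
      unfolding t(1) N prod.case coefficient_eq_alternating_sum[OF t(2-4)] of_int_sum sum_distrib_left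
      by (intro sum.cong refl) (simp add: mult_ac)
  qed
  also have "\<dots> = sum_pos3 (\<lambda>p1 p2 p3. poly_binom X1 p1 * poly_binom X2 p2 * poly_binom X3 p3 *
      of_int (coefficient N p1 p2 p3))"
    using coefficient_nonzero[of N] by (intro sum_pos3_eq[symmetric]) auto
  finally show ?thesis unfolding coefficient_def .
qed

end
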